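(* Let $N\geq 1$ be an integer, $m\in\{1,\ldots,N\}$, $k\in\{1,\ldots,m+1\}$ and $0<a\leq 1$. Then $$F_N^{m,k}(a)=(1+a^2)^{\frac{N(N+1)}{2}}\prod_{j=k}^{m}\frac{1}{\kappa_N^{m,j}(a)},$$ where $F_N^{m,k}(a)=\sum_{T\in\mathcal T(A_N^{m,k})}a^{v(T)}$ is the generating function of the number of vertical dominoes in domino tilings of the reduced Aztec diamond $A_N^{m,k}$, and $\kappa_N^{m,j}(a)$ is the leading coefficient of the numerator of the Padé approximant defined in the context (the empty product for $k=m+1$ equals $1$). In particular, the number of domino tilings of $A_N^{m,k}$ is equal to $2^{\frac{N(N+1)}{2}}\prod_{j=k}^{m}\frac{1}{\kappa_N^{m,j}(1)}$.
   Context: For integers $i,l$ let $S_{i,l}=[i,i+1]\times[l,l+1]\subset\mathbb R^2$. For integers $N\ge 1$, $m\in\{1,\ldots,N\}$, $k\in\{1,\ldots,m+1\}$, the reduced Aztec diamond $A_N^{m,k}$ is the union of all unit squares $S_{i,l}$ ($i,l\in\mathbb Z$) contained in $$\{(x,y)\in\mathbb R^2:\ |x|+|y|\leq N+1\ \text{ and }\ y\leq\max\{2m-1-N-x,\ x-2m-1+N+2k\}\}.$$ (For $k=m+1$ this is the full Aztec diamond $A_N$, the union of all $S_{i,l}$ contained in $\{|x|+|y|\le N+1\}$.) A domino is a rectangle $[i,i+1]\times[l,l+2]$ (vertical domino) or $[i,i+2]\times[l,l+1]$ (horizontal domino) with $i,l\in\mathbb Z$. A domino tiling of a region is a collection of dominoes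 contained in the region, with pairwise disjoint interiors, whose union is the region. $\mathcal T(A_N^{m,k})$ is the set of all domino tilings of $A_N^{m,k}$, and $v(T)$ is the number of vertical dominoes in $T$. Padé approximant: for $j\in\{1,\ldots,m\}$ let $f_N^{m,j}(z;a)=z^{m-j}(1-az)^{N-m+1}$. Let $p_N^{m,j}(z;a)$ be a polynomial in $z$ of degree at most $m-j$ and $q_N^{m,j}(z;a)$ a polynomial in $z$ of degree at most $j-1$, normalized by $q_N^{m,j}(0;a)=1$, such that $$p_N^{m,j}(z;a)-f_N^{m,j}(z;a)\,q_N^{m,j}(z;a)=O((z+a)^m),\qquad z\to -a.$$ This is a linear system of $m$ equations for the $m$ unknown coefficients, and such a pair exists and is unique. The number $\kappa_N^{m,j}(a)$ denotes the leading coefficient of $p_N^{m,j}(z;a)$, i.e. its coefficient of $z^{m-j}$. *)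

theory Defs
  imports
    "HOL-Analysis.Analysis"
    "HOL-Computational_Algebra.Polynomial"
    "HOL-Library.Landau_Symbols"
begin

definition unit_square :: "int \<Rightarrow> int \<Rightarrow> (real \<times> real) set" where
  "unit_square i l = {of_int i .. of_int i + 1} \<times> {of_int l .. of_int l + 1}"

definition reduced_aztec_bound :: "nat \<Rightarrow> nat \<Rightarrow> nat \<Rightarrow> (real \<times> real) set" where
  "reduced_aztec_bound N m k =
     {(x, y). \<bar>x\<bar> + \<bar>y\<bar> \<le> real N + 1 \<and>
              y \<le> max (2 * real m - 1 - real N - x) (x - 2 * real m - 1 + real N + 2 * real k)}"

definition reduced_aztec :: "nat \<Rightarrow> nat \<Rightarrow> nat \<Rightarrow> (real \<times> real) set" where
  "reduced_aztec N m k =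
     \<Union>{S. \<exists>i l. S = unit_square i l \<and> S \<subseteq> reduced_aztec_bound N m k}"

definition vertical_domino :: "(real \<times> real) set \<Rightarrow> bool" where
  "vertical_domino D \<longleftrightarrow>
     (\<exists>i l :: int. D = {of_int i .. of_int i + 1} \<times> {of_int l .. of_int l + 2})"

definition horizontal_domino :: "(real \<times> real) set \<Rightarrow> bool" where
  "horizontal_domino D \<longleftrightarrow>
     (\<exists>i l :: int. D = {of_int i .. of_int i + 2} \<times> {of_int l .. of_int l + 1})"

definition domino_tiling :: "(real \<times> real) set \<Rightarrow> (real \<times> real) set set \<Rightarrow> bool" where
  "domino_tiling R T \<longleftrightarrow>
     (\<forall>D\<in>T. (vertical_domino D \<or> horizontal_domino D) \<and> D \<subseteq> R) \<and>
     pairwise (\<lambda>D E. interior D \<inter> interior E = {}) T \<and>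
     \<Union>T = R"

definition tilings :: "(real \<times> real) set \<Rightarrow> (real \<times> real) set set set" where
  "tilings R = {T. domino_tiling R T}"

definition num_vertical :: "(real \<times> real) set set \<Rightarrow> nat" where
  "num_vertical T = card {D \<in> T. vertical_domino D}"

definition gen_fun :: "nat \<Rightarrow> nat \<Rightarrow> nat \<Rightarrow> real \<Rightarrow> real" where
  "gen_fun N m k a = (\<Sum>T\<in>tilings (reduced_aztec N m k). a ^ num_vertical T)"

text \<open>The natural-number subtractions below are only meant for \<open>1 \<le> j \<le> m \<le> N\<close>,
  where none of them truncates.\<close>

definition pade_target :: "nat \<Rightarrow> nat \<Rightarrow> nat \<Rightarrow> real \<Rightarrow> real \<Rightarrow> real" where
  "pade_target N m j a z = z ^ (m - j) * (1 - a * z) ^ (N - m + 1)"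

definition is_pade :: "nat \<Rightarrow> nat \<Rightarrow> nat \<Rightarrow> real \<Rightarrow> real poly \<Rightarrow> real poly \<Rightarrow> bool" where
  "is_pade N m j a p q \<longleftrightarrow>
     degree p \<le> m - j \<and> degree q \<le> j - 1 \<and> poly q 0 = 1 \<and>
     (\<lambda>z. poly p z - pade_target N m j a z * poly q z) \<in> O[at (- a)](\<lambda>z. (z + a) ^ m)"

text \<open>Real coefficients suffice because \<open>a\<close> is real: the approximation condition is a real linear
  system with a unique solution. The ``leading coefficient'' is the coefficient of \<open>z ^ (m - j)\<close>.\<close>

definition pade_pair :: "nat \<Rightarrow> nat \<Rightarrow> nat \<Rightarrow> real \<Rightarrow> real poly \<times> real poly" where
  "pade_pair N m j a = (THE (p, q). is_pade N m j a p q)"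

definition kappa :: "nat \<Rightarrow> nat \<Rightarrow> nat \<Rightarrow> real \<Rightarrow> real" where
  "kappa N m j a = coeff (fst (pade_pair N m j a)) (m - j)"

end

theory Submission
  imports
    Defs
    "HOL-Computational_Algebra.Formal_Power_Series"
    "Jordan_Normal_Form.Determinant"
begin

text \<open>A domino joins a square on a diagonal \<open>x + y = const\<close> to a square on the next diagonal. Peeling
  off the squares one by one from the left, the weighted number of completions to the right of a
  diagonal is, as a function of the squares on it that are matched to the right (the particles), a
  determinant whose rows are coefficients of power series, one row per particle. Going back past a
  diagonal on which particles jump multiplies the series by \<open>a + z\<close>; going back past a diagonal on
  which holes jump multiplies them by \<open>1 / (1 - a z)\<close> and turns one particle row into the row of the
  boundary coefficients \<open>z ^ N\<close>. To the right of the cut-off corner that row can be eliminated by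
  column operations, and the corner itself acts by filling the top sites. In the end \<open>F\<close> is
  \<open>(1 + a\<^sup>2) ^ ((N - m) (N - m + 1) / 2)\<close> times an \<open>m \<times> m\<close> determinant \<open>D\<^sub>k\<close> whose columns are, after
  the reversal \<open>z \<mapsto> - 1 / z\<close>, the residues modulo \<open>(z + a) ^ m\<close> of \<open>z ^ (m - j) (1 - a z) ^ (N - m + 1)\<close>
  for \<open>j < k\<close> and of \<open>z ^ (m - j)\<close> for \<open>j \<ge> k\<close>. The defining congruence of the Pade approximant is exactly
  a column operation that shows \<open>D\<^bsub>k+1\<^esub> = \<kappa>\<^sub>k D\<^sub>k\<close>, and the uncut diamond gives \<open>D\<^bsub>m+1\<^esub>\<close>.
  Since the region has a tiling, all \<open>D\<^sub>k\<close> are nonzero, which also makes the approximant unique.\<close>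

section \<open>Particles, holes and alternating forms\<close>

text \<open>The list holds the squares of one diagonal that still have to be matched to the next diagonal,
  \<open>Q\<close> the squares of the next diagonal that are still free, and \<open>A Q\<close> is the weight of
  completing the tiling. The two sums belong to the two kinds of diagonals, where matched squares
  are regarded as particles and as holes, respectively.\<close>

fun particle_sum :: "real \<Rightarrow> (nat set \<Rightarrow> real) \<Rightarrow> nat list \<Rightarrow> nat set \<Rightarrow> real" where
  "particle_sum a A [] Q = A Q"
| "particle_sum a A (x # xs) Q =
     (if x \<in> Q then a * particle_sum a A xs (Q - {x}) else 0) +
     (if 0 < x \<and> x - 1 \<in> Q then particle_sum a A xs (Q - {x - 1}) else 0)"

fun hole_sum :: "real \<Rightarrow> (nat set \<Rightarrow> real) \<Rightarrow> nat list \<Rightarrow> nat set \<Rightarrow> real" where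
  "hole_sum a A [] Q = A Q"
| "hole_sum a A (x # xs) Q =
     (if x \<in> Q then hole_sum a A xs (Q - {x}) else 0) +
     (if x + 1 \<in> Q then a * hole_sum a A xs (Q - {x + 1}) else 0)"

text \<open>No jump may use a site of \<open>B\<close> that has to be free at the end, so
  \<open>B\<close> can be removed from the free sites beforehand. This is how a shortened diagonal
  is compared with a full one at the corner.\<close>

lemma hole_sum_occupied:
  "hole_sum a (\<lambda>Q. if B \<subseteq> Q then A (Q - B) else 0) xs Q =
     (if B \<subseteq> Q then hole_sum a A xs (Q - B) else 0)"
proof (induction xs arbitrary: Q)
  case Nil
  then show ?case by simp
next
  case (Cons x xs)
  have *: "(if y \<in> Q then (if B \<subseteq> Q - {y} then hole_sum a A xs (Q - {y} - B) else 0) else 0) =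
     (if B \<subseteq> Q then if y \<in> Q - B then hole_sum a A xs (Q - B - {y}) else 0 else 0)" for y
  proof (cases "y \<in> B")
    case True
    then show ?thesis by auto
  next
    case False
    then have "B \<subseteq> Q - {y} \<longleftrightarrow> B \<subseteq> Q" "Q - {y} - B = Q - B - {y}" by auto
    then show ?thesis using False by simp
  qed
  have **: "(if y \<in> Q then a * (if B \<subseteq> Q - {y} then hole_sum a A xs (Q - {y} - B) else 0) else 0) =
     (if B \<subseteq> Q then if y \<in> Q - B then a * hole_sum a A xs (Q - B - {y}) else 0 else 0)" for y
    using *[of y] by (auto split: if_splits)
  show ?case
    unfolding hole_sum.simps Cons.IH * ** by simp
qed

text \<open>The two summation formulas below use only multilinearity and alternation of a
  determinant in its \<open>m\<close> rows. Stating them for such a form allows a fixed list of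
  further rows at the end to be carried along.\<close>

locale alternating_form =
  fixes \<Phi> :: "(nat \<Rightarrow> real) list \<Rightarrow> real" and m :: nat
  assumes linear: "length xs + length ys + 1 = m \<Longrightarrow>
      \<Phi> (xs @ (\<lambda>j. b * u j + c * v j) # ys) = b * \<Phi> (xs @ u # ys) + c * \<Phi> (xs @ v # ys)"
    and alternating: "length xs + length ys + length zs + 2 = m \<Longrightarrow>
      \<Phi> (xs @ u # ys @ u # zs) = 0"
begin

lemma scale: "length xs + length ys + 1 = m \<Longrightarrow> \<Phi> (xs @ (\<lambda>j. b * u j) # ys) = b * \<Phi> (xs @ u # ys)"
  using linear[of xs ys b u 0 u] by simp

lemma repeated:
  assumes "length rs + length zs + 1 = m" "u \<in> set rs"
  shows "\<Phi> (rs @ u # zs) = 0"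
proof -
  obtain xs ys where "rs = xs @ u # ys" using assms(2) by (meson split_list)
  then show ?thesis using alternating[of xs ys zs u] assms(1) by simp
qed

lemma add_multiple:
  assumes "length rs + length zs + 1 = m" "u \<in> set rs"
  shows "\<Phi> (rs @ (\<lambda>j. v j + c * u j) # zs) = \<Phi> (rs @ v # zs)"
  using linear[of rs zs 1 v c u] repeated[OF assms] assms(1) by simp

text \<open>The vanishing hypothesis at \<open>n\<close> encodes that the sites carrying \<open>ys\<close> are only \<open>{..<n}\<close>,
  while those carrying \<open>xs\<close> are \<open>{..n}\<close>.\<close>

lemma particle_sum_eq:
  assumes A: "\<And>ys. sorted_wrt (<) ys \<Longrightarrow> set ys \<subseteq> {..<n} \<Longrightarrow> length ys = q \<Longrightarrow>
      A ({..<n} - set ys) = \<Phi> (map G ys @ \<tau>)"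
    and A0: "\<And>ys. sorted_wrt (<) ys \<Longrightarrow> set ys \<subseteq> {..<n} \<Longrightarrow> Suc (length ys) = q \<Longrightarrow>
      \<Phi> (map G ys @ G n # \<tau>) = 0"
    and H: "\<And>x. H x = (\<lambda>j. a * G x j + (if x = 0 then 0 else G (x - 1) j))"
    and m: "q + length \<tau> = m"
  shows "sorted_wrt (<) (ys @ xs) \<Longrightarrow> set xs \<subseteq> {..n} \<Longrightarrow> set ys \<subseteq> {..<n} \<Longrightarrow>
     length ys + length xs = q \<Longrightarrow>
     particle_sum a A xs ({..<n} - set ys) = \<Phi> (map G ys @ map H xs @ \<tau>)"
proof (induction xs arbitrary: ys)
  case Nil
  then show ?case using A[of ys] by simp
next
  case (Cons x xs)
  have ysx: "\<And>y. y \<in> set ys \<Longrightarrow> y < x" and sxs: "sorted_wrt (<) xs" and xxs: "\<And>y. y \<in> set xs \<Longrightarrow> x < y"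
    and sys: "sorted_wrt (<) ys"
    using Cons.prems(1) by (auto simp: sorted_wrt_append)
  have len: "length (map G ys) + length (map H xs @ \<tau>) + 1 = m"
    using Cons.prems(4) m by simp
  \<comment> \<open>A particle at \<open>n\<close> has no site straight ahead, so the sum has no
    such term. It is then the last particle, and \<open>A0\<close> makes the determinant side vanish
    as well.\<close>
  have up: "(if x \<in> {..<n} - set ys then particle_sum a A xs ({..<n} - set ys - {x}) else 0) =
      \<Phi> (map G ys @ G x # map H xs @ \<tau>)"
  proof (cases "x < n")
    case True
    have "particle_sum a A xs ({..<n} - set (ys @ [x])) = \<Phi> (map G (ys @ [x]) @ map H xs @ \<tau>)"
      by (rule Cons.IH) (use Cons.prems True in auto)
    moreover have "{..<n} - set (ys @ [x]) = {..<n} - set ys - {x}" by auto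
    ultimately show ?thesis using True ysx by auto
  next
    case False
    then have xn: "x = n" using Cons.prems(2) by auto
    then have "xs = []" using xxs Cons.prems(2) by (cases xs) force+
    then show ?thesis using xn A0[of ys] Cons.prems sys by simp
  qed
  \<comment> \<open>If the previous particle already took site \<open>x - 1\<close>, the jump is
    forbidden; on the other side the row \<open>G (x - 1)\<close> then occurs twice. Exclusion is
    thus encoded by alternation.\<close>
  have down: "(if x - 1 \<in> {..<n} - set ys then particle_sum a A xs ({..<n} - set ys - {x - 1}) else 0) =
      \<Phi> (map G ys @ G (x - 1) # map H xs @ \<tau>)" if x0: "x > 0"
  proof (cases "x - 1 \<in> set ys")
    case True
    have "\<Phi> (map G ys @ G (x - 1) # map H xs @ \<tau>) = 0"
      by (rule repeated[OF len]) (use True in auto)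
    then show ?thesis using True by simp
  next
    case False
    have "x - 1 < n" using Cons.prems(2) x0 by auto
    have "y < x - 1" if "y \<in> set ys" for y
      using ysx[OF that] False that by (cases "y = x - 1") auto
    then have "sorted_wrt (<) (ys @ (x - 1) # xs)"
      using Cons.prems(1) xxs by (fastforce simp: sorted_wrt_append)
    then have "particle_sum a A xs ({..<n} - set (ys @ [x - 1])) = \<Phi> (map G (ys @ [x - 1]) @ map H xs @ \<tau>)"
      by (intro Cons.IH) (use Cons.prems \<open>x - 1 < n\<close> in auto)
    moreover have "{..<n} - set (ys @ [x - 1]) = {..<n} - set ys - {x - 1}" by auto
    ultimately show ?thesis using False \<open>x - 1 < n\<close> by auto
  qed
  show ?case
  proof (cases "x = 0")
    case True
    have "particle_sum a A (x # xs) ({..<n} - set ys) = a * \<Phi> (map G ys @ G x # map H xs @ \<tau>)"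
      using True up by auto
    also have "\<dots> = \<Phi> (map G ys @ H x # map H xs @ \<tau>)"
      using scale[OF len, of a "G x"] H[of x] True by simp
    finally show ?thesis by simp
  next
    case False
    have "particle_sum a A (x # xs) ({..<n} - set ys) =
        a * \<Phi> (map G ys @ G x # map H xs @ \<tau>) + \<Phi> (map G ys @ G (x - 1) # map H xs @ \<tau>)"
      unfolding particle_sum.simps using False up[symmetric] down[symmetric] by simp
    also have "\<dots> = \<Phi> (map G ys @ H x # map H xs @ \<tau>)"
      using linear[OF len, of a "G x" 1 "G (x - 1)"] H[of x] False by simp
    finally show ?thesis by simp
  qed
qed

end

section \<open>Hole jumps as sums over interlacing particle configurations\<close>

context
  fixes a :: real and g :: "nat \<Rightarrow> nat \<Rightarrow> real"
begin

definition partial :: "nat \<Rightarrow> nat \<Rightarrow> nat \<Rightarrow> real" where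
  "partial i y = (\<lambda>j. \<Sum>x=i..y. a ^ (y - x) * g x j)"

text \<open>Particles \<open>y0 < y1 < ...\<close> on an even diagonal are compatible with the
  interlacing particles \<open>x0 <= y0 < x1 <= y1 < ...\<close> on the next diagonal. The holes at
  the sites \<open>x, ..., y - 1\<close> then all jump up, which gives \<open>a ^ (y - x)\<close>.
  Summing each \<open>x\<close> over its block yields these rows.\<close>

fun partial_rows :: "nat \<Rightarrow> nat list \<Rightarrow> (nat \<Rightarrow> real) list" where
  "partial_rows i [] = []"
| "partial_rows i (y # ys) = partial i y # partial_rows (Suc y) ys"

end

lemma length_partial_rows [simp]: "length (partial_rows a g i ys) = length ys"
  by (induction ys arbitrary: i) auto

lemma partial_first: "i < y \<Longrightarrow> partial a g i y = (\<lambda>j. partial a g (Suc i) y j + a ^ (y - i) * g i j)"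
  by (rule ext) (simp add: partial_def sum.atLeast_Suc_atMost)

lemma partial_same: "partial a g i i = g i"
  by (simp add: partial_def)

lemma partial_split:
  assumes "y < z"
  shows "partial a g 0 z = (\<lambda>j. partial a g (Suc y) z j + a ^ (z - y) * partial a g 0 y j)"
proof
  fix j
  have "{0..z} = {0..y} \<union> {Suc y..z}" using assms by auto
  then have "partial a g 0 z j = (\<Sum>x=0..y. a ^ (z - x) * g x j) + partial a g (Suc y) z j"
    by (simp add: partial_def sum.union_disjoint)
  also have "(\<Sum>x=0..y. a ^ (z - x) * g x j) = (\<Sum>x=0..y. a ^ (z - y) * (a ^ (y - x) * g x j))"
    by (rule sum.cong) (use assms in \<open>auto simp: power_add[symmetric]\<close>)
  finally show "partial a g 0 z j = partial a g (Suc y) z j + a ^ (z - y) * partial a g 0 y j"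
    by (simp add: partial_def sum_distrib_left)
qed

context alternating_form
begin

text \<open>Sites are scanned upwards, and \<open>xs\<close> collects the sites below
  \<open>i\<close> that stay free. The two claims are the two states of the scan: site
  \<open>i\<close> is still free, or the hole just below has taken it. In the second state all holes
  before the next particle \<open>hd ys\<close> are pushed up, which explains the power of
  \<open>a\<close>.\<close>

lemma hole_sum_aux:
  assumes A: "\<And>xs. sorted_wrt (<) xs \<Longrightarrow> set xs \<subseteq> {..N} \<Longrightarrow> length xs = q \<Longrightarrow>
      A (set xs) = \<Phi> (map g xs @ \<tau>)"
    and m: "q + length \<tau> = m"
  shows "N + 1 - i = d \<Longrightarrow> sorted_wrt (<) xs \<Longrightarrow> set xs \<subseteq> {..<i} \<Longrightarrow> sorted_wrt (<) ys \<Longrightarrow>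
      set ys \<subseteq> {i..N} \<Longrightarrow> i \<le> N + 1 \<Longrightarrow> (i \<le> N \<Longrightarrow> N \<in> set ys) \<Longrightarrow>
      (length xs + length ys = q \<longrightarrow>
       hole_sum a A (filter (\<lambda>p. p \<notin> set ys) [i..<N]) (set xs \<union> {i..N})
          = \<Phi> (map g xs @ partial_rows a g i ys @ \<tau>)) \<and>
      (length xs + length (tl ys) = q \<longrightarrow> ys \<noteq> [] \<longrightarrow>
       hole_sum a A (filter (\<lambda>p. p \<notin> set ys) [i..<N]) (set xs \<union> {Suc i..N})
          = a ^ (hd ys - i) * \<Phi> (map g xs @ partial_rows a g (Suc (hd ys)) (tl ys) @ \<tau>))"
proof (induction d arbitrary: i xs ys)
  case 0
  then have "i = N + 1" by simp
  then have "ys = []" using 0 by (cases ys) auto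
  moreover have "set xs \<subseteq> {..N}" using 0 \<open>i = N + 1\<close> by (auto simp: less_Suc_eq_le)
  ultimately show ?case using A[of xs] 0 \<open>i = N + 1\<close> by auto
next
  case (Suc d)
  have i: "i \<le> N" using Suc.prems by simp
  then obtain y ys' where ys: "ys = y # ys'" using Suc.prems(7) by (cases ys) auto
  have y: "i \<le> y" "y \<le> N" and ys': "sorted_wrt (<) ys'" "set ys' \<subseteq> {Suc y..N}"
    using Suc.prems ys by (auto simp: Suc_le_eq) fastforce+
  have sx: "sorted_wrt (<) (xs @ [i])" "set (xs @ [i]) \<subseteq> {..<Suc i}"
    using Suc.prems by (auto simp: sorted_wrt_append)
  have sx': "set xs \<subseteq> {..<Suc i}" using sx by auto
  have Q1: "set (xs @ [i]) \<union> {Suc i..N} = set xs \<union> {i..N}" using i by auto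
  show ?case
  proof (cases "y = i")
    case True
    have f: "filter (\<lambda>p. p \<notin> set ys) [i..<N] = filter (\<lambda>p. p \<notin> set ys') [Suc i..<N]"
    proof (cases "i < N")
      case True': True
      have "[i..<N] = i # [Suc i..<N]" using True' by (rule upt_conv_Cons)
      then show ?thesis using True ys by (auto intro: filter_cong)
    qed simp
    have N: "Suc i \<le> N \<Longrightarrow> N \<in> set ys'" using Suc.prems(7) ys True i by auto
    have IH1: "length xs + 1 + length ys' = q \<longrightarrow>
       hole_sum a A (filter (\<lambda>p. p \<notin> set ys') [Suc i..<N]) (set (xs @ [i]) \<union> {Suc i..N})
          = \<Phi> (map g (xs @ [i]) @ partial_rows a g (Suc i) ys' @ \<tau>)"
      using Suc.IH[of "Suc i" "xs @ [i]" ys'] Suc.prems sx ys' True N by auto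
    have IH2: "length xs + length ys' = q \<longrightarrow>
       hole_sum a A (filter (\<lambda>p. p \<notin> set ys') [Suc i..<N]) (set xs \<union> {Suc i..N})
          = \<Phi> (map g xs @ partial_rows a g (Suc i) ys' @ \<tau>)"
      using Suc.IH[of "Suc i" xs ys'] Suc.prems sx' ys' True N by auto
    show ?thesis using IH1 IH2 unfolding f unfolding ys Q1 using True by (simp add: partial_same)
  next
    case False
    then have iy: "i < y" using y by simp
    then have iN: "i < N" using y by simp
    have f: "filter (\<lambda>p. p \<notin> set ys) [i..<N] = i # filter (\<lambda>p. p \<notin> set ys) [Suc i..<N]"
    proof -
      have "[i..<N] = i # [Suc i..<N]" using iN by (rule upt_conv_Cons)
      moreover have "i \<notin> set ys" using ys ys' iy by auto
      ultimately show ?thesis by simp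
    qed
    have sy: "set ys \<subseteq> {Suc i..N}" using ys ys' iy y by auto
    have inx: "i \<notin> set xs" "Suc i \<notin> set xs" using Suc.prems(3) by auto
    let ?f = "filter (\<lambda>p. p \<notin> set ys) [Suc i..<N]"
    have N: "N \<in> set ys" using Suc.prems(7) i by auto
    have IH1: "length xs + length ys = q \<longrightarrow>
       hole_sum a A ?f (set xs \<union> {Suc i..N}) = \<Phi> (map g xs @ partial_rows a g (Suc i) ys @ \<tau>)"
      using Suc.IH[of "Suc i" xs ys] Suc.prems sx' sy N iN by auto
    have IH2: "length xs + 1 + length ys' = q \<longrightarrow>
       hole_sum a A ?f (set (xs @ [i]) \<union> {Suc (Suc i)..N}) =
        a ^ (y - Suc i) * \<Phi> (map g (xs @ [i]) @ partial_rows a g (Suc y) ys' @ \<tau>)"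
      using Suc.IH[of "Suc i" "xs @ [i]" ys] Suc.prems sx sy N iN ys by auto
    have IH3: "length xs + length ys' = q \<longrightarrow>
       hole_sum a A ?f (set xs \<union> {Suc (Suc i)..N}) =
        a ^ (y - Suc i) * \<Phi> (map g xs @ partial_rows a g (Suc y) ys' @ \<tau>)"
      using Suc.IH[of "Suc i" xs ys] Suc.prems sx' sy N iN ys by auto
    have s1: "(set xs \<union> {i..N}) - {i} = set xs \<union> {Suc i..N}" using inx by auto
    have s2: "(set xs \<union> {i..N}) - {i + 1} = set (xs @ [i]) \<union> {Suc (Suc i)..N}" using inx iN by auto
    have s3: "(set xs \<union> {Suc i..N}) - {i + 1} = set xs \<union> {Suc (Suc i)..N}" using inx iN by auto
    have e: "a * a ^ (y - Suc i) = a ^ (y - i)"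
      using iy by (metis Suc_diff_Suc power_Suc)
    \<comment> \<open>If the hole at \<open>i\<close> jumps to site \<open>i\<close>, the free site
      of this block comes later; if it jumps up, the free site is \<open>i\<close> itself. These are
      the two parts of the block sum \<open>partial a g i y\<close>.\<close>
    have first: "hole_sum a A (i # ?f) (set xs \<union> {i..N}) = \<Phi> (map g xs @ partial_rows a g i ys @ \<tau>)"
      if len: "length xs + length ys = q"
    proof -
      have "hole_sum a A (i # ?f) (set xs \<union> {i..N}) =
         \<Phi> (map g xs @ partial_rows a g (Suc i) ys @ \<tau>) +
         a ^ (y - i) * \<Phi> (map g xs @ g i # partial_rows a g (Suc y) ys' @ \<tau>)"
        unfolding hole_sum.simps s1 s2 using IH1 IH2 len iN ys by (simp add: e[symmetric])
      also have "\<dots> = \<Phi> (map g xs @ partial a g i y # partial_rows a g (Suc y) ys' @ \<tau>)"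
        using linear[of "map g xs" "partial_rows a g (Suc y) ys' @ \<tau>" 1 "partial a g (Suc i) y" "a ^ (y - i)" "g i"]
          partial_first[OF iy, of a g] len ys m by simp
      finally show ?thesis using ys by simp
    qed
    have second: "hole_sum a A (i # ?f) (set xs \<union> {Suc i..N}) =
        a ^ (y - i) * \<Phi> (map g xs @ partial_rows a g (Suc y) ys' @ \<tau>)"
      if len: "length xs + length ys' = q"
      unfolding hole_sum.simps s3 using inx IH3 len iN by (simp add: e[symmetric])
    show ?thesis using first second unfolding f unfolding ys by simp
  qed
qed

text \<open>By \<open>partial_split\<close>, a full sum from 0 differs from the block sum by a
  multiple of the preceding full sum. Row operations from the top therefore remove the dependence of
  each row on its predecessor.\<close>

lemma partial_rows_eq:
  assumes "length zs + length ys + length \<tau> = m" "sorted_wrt (<) (zs @ ys)"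
    and "i = (if zs = [] then 0 else Suc (last zs))"
  shows "\<Phi> (map (partial a g 0) zs @ partial_rows a g i ys @ \<tau>) = \<Phi> (map (partial a g 0) (zs @ ys) @ \<tau>)"
  using assms
proof (induction ys arbitrary: zs i)
  case Nil
  then show ?case by simp
next
  case (Cons y ys)
  have "\<Phi> (map (partial a g 0) zs @ partial a g i y # partial_rows a g (Suc y) ys @ \<tau>) =
        \<Phi> (map (partial a g 0) zs @ partial a g 0 y # partial_rows a g (Suc y) ys @ \<tau>)"
  proof (cases "zs = []")
    case True
    then show ?thesis using Cons.prems by simp
  next
    case False
    then have l: "last zs < y" using Cons.prems(2) by (auto simp: sorted_wrt_append)
    show ?thesis
      unfolding partial_split[OF l]
      using False Cons.prems
      by (subst add_multiple) auto
  qed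
  also have "\<dots> = \<Phi> (map (partial a g 0) (zs @ [y]) @ partial_rows a g (Suc y) ys @ \<tau>)"
    by simp
  also have "\<dots> = \<Phi> (map (partial a g 0) ((zs @ [y]) @ ys) @ \<tau>)"
    by (rule Cons.IH) (use Cons.prems in auto)
  finally show ?case by simp
qed

text \<open>An artificial particle at \<open>N\<close> is appended to \<open>ys\<close>. It closes
  the last block, and its row is the boundary row that replaces one of the \<open>Suc q\<close>
  particle rows.\<close>

lemma hole_sum_eq:
  assumes A: "\<And>xs. sorted_wrt (<) xs \<Longrightarrow> set xs \<subseteq> {..N} \<Longrightarrow> length xs = Suc q \<Longrightarrow>
      A (set xs) = \<Phi> (map g xs @ \<tau>)"
    and m: "Suc q + length \<tau> = m"
    and ys: "sorted_wrt (<) ys" "set ys \<subseteq> {..<N}" "length ys = q"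
  shows "hole_sum a A (filter (\<lambda>p. p \<notin> set ys) [0..<N]) {..N} =
     \<Phi> (map (partial a g 0) ys @ partial a g 0 N # \<tau>)"
proof -
  have f: "filter (\<lambda>p. p \<notin> set ys) [0..<N] = filter (\<lambda>p. p \<notin> set (ys @ [N])) [0..<N]"
    by (rule filter_cong) auto
  have s: "sorted_wrt (<) (ys @ [N])" using ys by (auto simp: sorted_wrt_append)
  have "set (ys @ [N]) \<subseteq> {0..N}" using ys by auto
  then have "hole_sum a A (filter (\<lambda>p. p \<notin> set (ys @ [N])) [0..<N]) (set [] \<union> {0..N}) =
      \<Phi> (map g [] @ partial_rows a g 0 (ys @ [N]) @ \<tau>)"
    using hole_sum_aux[of N "Suc q" A g \<tau> 0 "N + 1" "[]" "ys @ [N]" a] A m ys s by auto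
  also have "\<dots> = \<Phi> (map (partial a g 0) (ys @ [N]) @ \<tau>)"
    using partial_rows_eq[of "[]" "ys @ [N]" \<tau> 0 a g] s m ys by simp
  finally show ?thesis using f by (simp add: atLeast0AtMost)
qed

end

section \<open>Determinants as functions of their rows\<close>

definition row_det :: "nat \<Rightarrow> (nat \<Rightarrow> real) list \<Rightarrow> real" where
  "row_det m rs = Determinant.det (Matrix.mat m m (\<lambda>(i, j). (rs ! i) j))"

lemma row_det_Leibniz:
  "row_det m rs = (\<Sum>p | p permutes {0..<m}. signof p * (\<Prod>i=0..<m. (rs ! i) (p i)))"
proof -
  have "row_det m rs = (\<Sum>p | p permutes {0..<m}. signof p *
      (\<Prod>i=0..<m. Matrix.mat m m (\<lambda>(i, j). (rs ! i) j) $$ (i, p i)))"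
    unfolding row_det_def by (rule det_def') simp
  also have "\<dots> = (\<Sum>p | p permutes {0..<m}. signof p * (\<Prod>i=0..<m. (rs ! i) (p i)))"
    by (intro sum.cong refl arg_cong2[of _ _ _ _ "(*)"] prod.cong)
      (auto simp: permutes_in_image)
  finally show ?thesis .
qed

lemma row_det_linear:
  assumes "length xs + length ys + 1 = m"
  shows "row_det m (xs @ (\<lambda>j. b * u j + c * v j) # ys) =
    b * row_det m (xs @ u # ys) + c * row_det m (xs @ v # ys)"
proof -
  let ?k = "length xs"
  have k: "?k \<in> {0..<m}" using assms by auto
  define R where "R p = (\<Prod>i\<in>{0..<m} - {?k}. ((xs @ u # ys) ! i) (p i))" for p
  have R: "(\<Prod>i=0..<m. ((xs @ w # ys) ! i) (p i)) = w (p ?k) * R p" for w p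
  proof -
    have "(\<Prod>i\<in>{0..<m} - {?k}. ((xs @ w # ys) ! i) (p i)) = R p"
      unfolding R_def by (rule prod.cong) (auto simp: nth_append nth_Cons split: nat.splits)
    then show ?thesis by (subst prod.remove[OF _ k]) auto
  qed
  show ?thesis
    unfolding row_det_Leibniz R
    by (simp add: sum_distrib_left sum.distrib[symmetric] algebra_simps)
qed

lemma row_det_repeated:
  assumes "length xs + length ys + length zs + 2 = m"
  shows "row_det m (xs @ u # ys @ u # zs) = 0"
  unfolding row_det_def
proof (rule det_identical_rows)
  show "length xs < m" "length xs + length ys + 1 < m" "length xs \<noteq> length xs + length ys + 1"
    using assms by auto
  let ?rs = "xs @ u # ys @ u # zs"
  have "?rs ! (length xs + length ys + 1) = u" by (simp add: nth_append)
  then show "row (Matrix.mat m m (\<lambda>(i, j). (?rs ! i) j)) (length xs) =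
    row (Matrix.mat m m (\<lambda>(i, j). (?rs ! i) j)) (length xs + length ys + 1)"
    using assms by (intro eq_vecI) auto
qed auto

text \<open>The scalar \<open>c\<close> carries the accumulated powers of
  \<open>1 + a\<^sup>2\<close> through the recursion.\<close>

lemma alternating_form_row_det: "alternating_form (\<lambda>rs. c * row_det m rs) m"
  by unfold_locales (simp_all add: row_det_linear row_det_repeated algebra_simps)

lemma row_det_zero_column:
  assumes "j < m" "length rs = m" "\<And>r. r \<in> set rs \<Longrightarrow> r j = 0"
  shows "row_det m rs = 0"
  unfolding row_det_Leibniz
proof (rule sum.neutral, safe)
  fix p assume p: "p permutes {0..<m}"
  obtain i where i: "i < m" "p i = j"
    using p assms(1) by (metis atLeastLessThan_iff permutes_in_image permutes_surj surjD zero_le)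
  then have "(\<Prod>i=0..<m. (rs ! i) (p i)) = 0"
    using assms by (intro prod_zero) (auto intro!: bexI[of _ i])
  then show "signof p * (\<Prod>i=0..<m. (rs ! i) (p i)) = 0" by simp
qed

lemma row_det_zero_row:
  assumes "length rs = m" "r \<in> set rs" "\<And>j. j < m \<Longrightarrow> r j = 0"
  shows "row_det m rs = 0"
  unfolding row_det_Leibniz
proof (rule sum.neutral, safe)
  fix p assume p: "p permutes {0..<m}"
  obtain i where i: "i < m" "rs ! i = r" using assms by (metis in_set_conv_nth)
  then have "p i < m" using p by (simp add: permutes_in_image[of p "{0..<m}", simplified])
  then have "(\<Prod>i=0..<m. (rs ! i) (p i)) = 0"
    using i assms by (intro prod_zero) (auto intro!: bexI[of _ i])
  then show "signof p * (\<Prod>i=0..<m. (rs ! i) (p i)) = 0" by simp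
qed

lemma row_det_block:
  assumes "length rs = p" "length ts = r"
    and "\<And>u j. u \<in> set rs \<Longrightarrow> p \<le> j \<Longrightarrow> j < p + r \<Longrightarrow> u j = 0"
    and "\<And>i j. i < r \<Longrightarrow> j < r \<Longrightarrow> (ts ! i) (p + j) = (if i = j then 1 else 0)"
  shows "row_det (p + r) (rs @ ts) = row_det p rs"
proof -
  let ?A = "Matrix.mat (p + r) (p + r) (\<lambda>(i, j). ((rs @ ts) ! i) j)"
  have "?A = four_block_mat (Matrix.mat p p (\<lambda>(i, j). (rs ! i) j)) (0\<^sub>m p r)
      (Matrix.mat r p (\<lambda>(i, j). (ts ! i) j)) (1\<^sub>m r)"
  proof (rule eq_matI, goal_cases)
    case (1 i j)
    then have ij: "i < p + r" "j < p + r" by auto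
    show ?case
    proof (cases "i < p")
      case True
      then have "rs ! i \<in> set rs" using assms(1) by simp
      then show ?thesis using True ij assms by (auto simp: nth_append)
    next
      case False
      then show ?thesis using ij assms(1,2) assms(4)[of "i - p" "j - p"] by (auto simp: nth_append)
    qed
  qed auto
  then show ?thesis
    unfolding row_det_def by (simp add: det_four_block_mat_upper_right_zero[of _ p _ r])
qed

section \<open>Rows of power series coefficients\<close>

definition geometric :: "real \<Rightarrow> real fps" where
  "geometric a = Abs_fps (\<lambda>n. a ^ n)"

lemma geometric_inverse: "(1 - fps_const a * fps_X) * geometric a = 1"
proof (rule fps_ext)
  fix n
  have "fps_nth ((1 - fps_const a * fps_X) * geometric a) n =
     fps_nth (geometric a) n - a * (if n = 0 then 0 else fps_nth (geometric a) (n - 1))"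
    by (simp add: left_diff_distrib mult.assoc)
  then show "fps_nth ((1 - fps_const a * fps_X) * geometric a) n = fps_nth 1 n"
    by (cases n) (auto simp: geometric_def)
qed

lemma partial_fps: "partial a (\<lambda>x j. fps_nth (F j) x) 0 y = (\<lambda>j. fps_nth (F j * geometric a) y)"
  by (rule ext) (simp add: partial_def fps_mult_nth geometric_def mult.commute)

lemma fps_nth_linear_mult:
  "fps_nth (F * (fps_const a + fps_X)) x = (a :: real) * fps_nth F x + (if x = 0 then 0 else fps_nth F (x - 1))"
  by (simp add: distrib_left mult.commute[of F])

lemma linear_power_nth_zero: "x > M \<Longrightarrow> fps_nth ((fps_const (a :: real) + fps_X) ^ M) x = 0"
proof (induction M arbitrary: x)
  case 0
  then show ?case by simp
next
  case (Suc M)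
  show ?case unfolding power_Suc2 fps_nth_linear_mult using Suc by simp
qed

lemma shifted_power_nth_zero: "x > j + M \<Longrightarrow> fps_nth (fps_X ^ j * (fps_const (a :: real) + fps_X) ^ M) x = 0"
  using linear_power_nth_zero[of M "x - j" a] by (simp add: fps_X_power_mult_nth)

text \<open>For coefficients of index at least \<open>M\<close> and nonzero \<open>a\<close>,
  dividing by \<open>1 - a z\<close> amounts to evaluating the numerator at \<open>1 / a\<close>,
  and \<open>a ^ n * (a + 1 / a) ^ M\<close> is the right-hand side.\<close>

lemma linear_power_geometric_nth:
  assumes "M \<le> n"
  shows "fps_nth ((fps_const a + fps_X) ^ M * geometric a) n = a ^ (n - M) * (1 + a\<^sup>2) ^ M"
  using assms
proof (induction M arbitrary: n)
  case 0
  then show ?case by (simp add: geometric_def)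
next
  case (Suc M)
  obtain n' where n: "n = Suc n'" using Suc.prems by (cases n) auto
  have e: "(fps_const a + fps_X) ^ Suc M * geometric a = ((fps_const a + fps_X) ^ M * geometric a) * (fps_const a + fps_X)"
    by (simp add: mult_ac)
  have "n - M = Suc (n' - M)" using Suc.prems n by simp
  then have "a * (a ^ (n - M) * (1 + a\<^sup>2) ^ M) + a ^ (n' - M) * (1 + a\<^sup>2) ^ M = a ^ (n' - M) * (1 + a\<^sup>2) ^ Suc M"
    by (simp add: algebra_simps power2_eq_square)
  then show ?case
    unfolding e fps_nth_linear_mult using Suc.IH[of n] Suc.IH[of n'] Suc.prems n by simp
qed

text \<open>Subtracting \<open>a\<close> times column \<open>j + 1\<close> from column
  \<open>j\<close> cancels the geometric factor in all columns but the last; this is multiplication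
  by \<open>U\<close>. The first \<open>q\<close> columns then have degree below \<open>n\<close>,
  so the last row has a single nonzero candidate, the corner entry
  \<open>(1 + a\<^sup>2) ^ M\<close>.\<close>

lemma row_det_reduce:
  assumes ys: "length ys = q" and n: "n = q + M"
  shows "row_det (Suc q)
      (map (\<lambda>y j. fps_nth (fps_X ^ j * (fps_const a + fps_X) ^ M * geometric a) y) ys @
       [\<lambda>j. fps_nth (fps_X ^ j * (fps_const a + fps_X) ^ M * geometric a) n]) =
     (1 + a\<^sup>2) ^ M * row_det q (map (\<lambda>y j. fps_nth (fps_X ^ j * (fps_const a + fps_X) ^ M) y) ys)"
proof -
  define F where "F j = fps_X ^ j * (fps_const a + fps_X) ^ M" for j :: nat
  define z where "z i = (ys @ [n]) ! i" for i
  define B where "B = Matrix.mat (Suc q) (Suc q) (\<lambda>(i, j). fps_nth (F j * geometric a) (z i))"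
  define U where "U = Matrix.mat (Suc q) (Suc q) (\<lambda>(i, j). if i = j then 1 else if i = Suc j then - a else 0)"
  have F: "F j * geometric a - fps_const a * (F (Suc j) * geometric a) = F j" for j
  proof -
    have "F j * geometric a - fps_const a * (F (Suc j) * geometric a) = F j * ((1 - fps_const a * fps_X) * geometric a)"
      by (simp add: F_def algebra_simps)
    then show ?thesis by (simp add: geometric_inverse)
  qed
  have det_U: "Determinant.det U = 1"
  proof -
    have "Determinant.det U = prod_list (diag_mat U)"
      by (rule det_lower_triangular[of "Suc q"]) (auto simp: U_def)
    also have "diag_mat U = map (\<lambda>i. 1) [0..<Suc q]"
      unfolding diag_mat_def by (rule map_cong) (auto simp: U_def)
    finally show ?thesis by (simp add: map_replicate_const)
  qed
  have BU: "(B * U) $$ (i, j) = (if j < q then fps_nth (F j) (z i) else fps_nth (F q * geometric a) (z i))"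
    if "i < Suc q" "j < Suc q" for i j
  proof -
    have "(B * U) $$ (i, j) = (\<Sum>l\<in>{0..<Suc q}. fps_nth (F l * geometric a) (z i) * U $$ (l, j))"
      using that by (simp add: B_def U_def scalar_prod_def)
    also have "\<dots> = (\<Sum>l\<in>{0..<Suc q}. (if l = j then fps_nth (F l * geometric a) (z i) else 0) +
        (if l = Suc j then - a * fps_nth (F l * geometric a) (z i) else 0))"
      by (rule sum.cong) (use that in \<open>auto simp: U_def\<close>)
    also have "\<dots> = fps_nth (F j * geometric a) (z i) +
        (if Suc j < Suc q then - a * fps_nth (F (Suc j) * geometric a) (z i) else 0)"
      using that by (subst sum.distrib) (simp only: sum.delta finite_atLeastLessThan, simp)
    also have "\<dots> = (if j < q then fps_nth (F j) (z i) else fps_nth (F q * geometric a) (z i))"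
    proof (cases "j < q")
      case True
      have "fps_nth (F j * geometric a) (z i) - a * fps_nth (F (Suc j) * geometric a) (z i) =
         fps_nth (F j * geometric a - fps_const a * (F (Suc j) * geometric a)) (z i)" by simp
      then show ?thesis using True F by simp
    next
      case False
      then have "j = q" using that by simp
      then show ?thesis by simp
    qed
    finally show ?thesis .
  qed
  have "row_det (Suc q) (map (\<lambda>y j. fps_nth (F j * geometric a) y) ys @ [\<lambda>j. fps_nth (F j * geometric a) n]) = Determinant.det B"
    unfolding row_det_def B_def
    by (intro arg_cong[of _ _ Determinant.det] eq_matI) (auto simp: z_def nth_append ys)
  also have "\<dots> = Determinant.det (B * U)"
    by (subst det_mult[of _ "Suc q"]) (auto simp: B_def U_def det_U[unfolded U_def])
  also have "B * U = four_block_mat (Matrix.mat q q (\<lambda>(i, j). fps_nth (F j) (z i)))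
      (Matrix.mat q 1 (\<lambda>(i, j). fps_nth (F q * geometric a) (z i))) (0\<^sub>m 1 q)
      (Matrix.mat 1 1 (\<lambda>_. (1 + a\<^sup>2) ^ M))"
  proof (rule eq_matI, goal_cases)
    case (1 i j)
    then have ij: "i < Suc q" "j < Suc q" by auto
    have "fps_nth (F j) n = 0" if "j < q"
      using that n unfolding F_def by (intro shifted_power_nth_zero) auto
    moreover have "fps_nth (F q * geometric a) n = (1 + a\<^sup>2) ^ M"
    proof -
      have e: "F q * geometric a = fps_X ^ q * ((fps_const a + fps_X) ^ M * geometric a)"
        by (simp add: F_def mult.assoc)
      show ?thesis unfolding e fps_X_power_mult_nth
        using n linear_power_geometric_nth[of M M a] by simp
    qed
    moreover have "z q = n" using ys by (simp add: z_def nth_append)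
    ultimately show ?case unfolding BU[OF ij] using ij by (auto simp: less_Suc_eq)
  qed (auto simp: B_def U_def)
  also have "Determinant.det \<dots> = Determinant.det (Matrix.mat q q (\<lambda>(i, j). fps_nth (F j) (z i))) * (1 + a\<^sup>2) ^ M"
    by (subst det_four_block_mat_lower_left_zero[of _ q _ 1]) (auto simp: det_single)
  also have "Determinant.det (Matrix.mat q q (\<lambda>(i, j). fps_nth (F j) (z i))) =
      row_det q (map (\<lambda>y j. fps_nth (F j) y) ys)"
    unfolding row_det_def
    by (intro arg_cong[of _ _ Determinant.det] eq_matI) (auto simp: z_def nth_append ys)
  finally show ?thesis by (simp add: F_def mult.commute)
qed

section \<open>Weighted matchings of squares\<close>

fun domino_cells :: "bool \<times> int \<times> int \<Rightarrow> (int \<times> int) set" where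
  "domino_cells (v, i, l) = {(i, l), if v then (i, l + 1) else (i + 1, l)}"

definition matchings :: "(int \<times> int) set \<Rightarrow> (bool \<times> int \<times> int) set set" where
  "matchings S = {E. (\<forall>d\<in>E. domino_cells d \<subseteq> S) \<and>
     pairwise (\<lambda>d e. domino_cells d \<inter> domino_cells e = {}) E \<and> S \<subseteq> \<Union>(domino_cells ` E)}"

definition weight :: "real \<Rightarrow> (int \<times> int) set \<Rightarrow> real" where
  "weight a S = (\<Sum>E\<in>matchings S. a ^ card {d \<in> E. fst d})"

lemma matchings_subset: "E \<in> matchings S \<Longrightarrow> E \<subseteq> UNIV \<times> S"
  by (fastforce simp: matchings_def)

lemma finite_matching: "finite S \<Longrightarrow> E \<in> matchings S \<Longrightarrow> finite E"
  by (rule finite_subset[OF matchings_subset]) auto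

lemma finite_matchings: "finite S \<Longrightarrow> finite (matchings S)"
  by (rule finite_subset[of _ "Pow (UNIV \<times> S)"]) (use matchings_subset in auto)

lemma weight_empty [simp]: "weight a {} = 1"
proof -
  have "matchings {} = {{}}" by (auto simp: matchings_def)
  then show ?thesis by (simp add: weight_def)
qed

lemma matchings_containing:
  assumes "domino_cells d \<subseteq> S"
  shows "{E \<in> matchings S. d \<in> E} = insert d ` matchings (S - domino_cells d)"
proof (intro equalityI subsetI)
  fix E assume "E \<in> {E \<in> matchings S. d \<in> E}"
  then have E: "E \<in> matchings S" "d \<in> E" by auto
  have disj: "domino_cells e \<inter> domino_cells d = {}" if "e \<in> E - {d}" for e
    using E that by (auto simp: matchings_def pairwise_def)
  have "E - {d} \<in> matchings (S - domino_cells d)"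
    unfolding matchings_def
  proof (intro CollectI conjI ballI)
    fix e assume e: "e \<in> E - {d}"
    then have "domino_cells e \<subseteq> S" using E by (auto simp: matchings_def)
    then show "domino_cells e \<subseteq> S - domino_cells d" using disj[OF e] by blast
  next
    show "pairwise (\<lambda>d e. domino_cells d \<inter> domino_cells e = {}) (E - {d})"
      using E by (auto simp: matchings_def pairwise_def)
  next
    have "S \<subseteq> \<Union>(domino_cells ` E)" using E by (simp add: matchings_def)
    then show "S - domino_cells d \<subseteq> \<Union>(domino_cells ` (E - {d}))" by blast
  qed
  moreover have "E = insert d (E - {d})" using E by auto
  ultimately show "E \<in> insert d ` matchings (S - domino_cells d)" by blast
next
  fix E assume "E \<in> insert d ` matchings (S - domino_cells d)"
  then obtain E' where E': "E' \<in> matchings (S - domino_cells d)" "E = insert d E'" by auto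
  have "E \<in> matchings S"
    unfolding matchings_def
  proof (intro CollectI conjI ballI)
    fix e assume "e \<in> E"
    then show "domino_cells e \<subseteq> S" using E' assms unfolding matchings_def by blast
  next
    show "pairwise (\<lambda>d e. domino_cells d \<inter> domino_cells e = {}) E"
      using E' unfolding matchings_def pairwise_insert E'(2) by blast
  next
    show "S \<subseteq> \<Union>(domino_cells ` E)" using E' unfolding matchings_def by blast
  qed
  then show "E \<in> {E \<in> matchings S. d \<in> E}" using E' by auto
qed

lemma sum_matchings_containing:
  assumes "finite S"
  shows "(\<Sum>E | E \<in> matchings S \<and> d \<in> E. a ^ card {e \<in> E. fst e}) =
    (if domino_cells d \<subseteq> S then (if fst d then a else 1) * weight a (S - domino_cells d) else 0)"
proof (cases "domino_cells d \<subseteq> S")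
  case False
  then have e: "{E. E \<in> matchings S \<and> d \<in> E} = {}" by (auto simp: matchings_def)
  show ?thesis unfolding e using False by simp
next
  case True
  have d: "d \<notin> E" if "E \<in> matchings (S - domino_cells d)" for E
  proof
    assume "d \<in> E"
    then have "domino_cells d \<subseteq> S - domino_cells d" using that by (auto simp: matchings_def)
    moreover have "domino_cells d \<noteq> {}" by (cases d) auto
    ultimately show False by blast
  qed
  have inj: "inj_on (insert d) (matchings (S - domino_cells d))"
    by (intro inj_onI) (metis d insert_ident)
  have w: "a ^ card {e \<in> insert d E. fst e} = (if fst d then a else 1) * a ^ card {e \<in> E. fst e}"
    if E: "E \<in> matchings (S - domino_cells d)" for E
  proof -
    have fin: "finite {e \<in> E. fst e}" using finite_matching[OF _ E] assms by auto
    have "{e \<in> insert d E. fst e} = (if fst d then insert d {e \<in> E. fst e} else {e \<in> E. fst e})" by auto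
    then show ?thesis using fin d[OF E] by simp
  qed
  have "(\<Sum>E | E \<in> matchings S \<and> d \<in> E. a ^ card {e \<in> E. fst e}) =
      (\<Sum>E\<in>matchings (S - domino_cells d). a ^ card {e \<in> insert d E. fst e})"
    using matchings_containing[OF True] by (simp add: sum.reindex[OF inj])
  also have "\<dots> = (\<Sum>E\<in>matchings (S - domino_cells d). (if fst d then a else 1) * a ^ card {e \<in> E. fst e})"
    by (intro sum.cong refl w)
  finally show ?thesis using True by (simp add: weight_def sum_distrib_left)
qed

text \<open>Without a left and a lower neighbour in \<open>S\<close>, the cell \<open>(i, l)\<close>
  must be the lower left cell of its domino, so its partner is the upper or the right
  neighbour.\<close>

lemma weight_peel:
  assumes S: "finite S" "(i, l) \<in> S" "(i - 1, l) \<notin> S" "(i, l - 1) \<notin> S"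
  shows "weight a S =
    (if (i, l + 1) \<in> S then a * weight a (S - {(i, l), (i, l + 1)}) else 0) +
    (if (i + 1, l) \<in> S then weight a (S - {(i, l), (i + 1, l)}) else 0)"
proof -
  let ?M = "\<lambda>v. {E. E \<in> matchings S \<and> (v, i, l) \<in> E}"
  have "E \<in> ?M True \<union> ?M False" if E: "E \<in> matchings S" for E
  proof -
    obtain d where d: "d \<in> E" "(i, l) \<in> domino_cells d" using E S(2) by (auto simp: matchings_def)
    obtain v i' l' where v: "d = (v, i', l')" by (cases d) auto
    have "domino_cells d \<subseteq> S" using E d by (auto simp: matchings_def)
    then have "i' = i \<and> l' = l" using d(2) S(3,4) unfolding v by (auto split: if_splits)
    then show ?thesis using d v E by (cases v) auto
  qed
  then have U: "matchings S = ?M True \<union> ?M False" by blast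
  have "E \<notin> ?M False" if "E \<in> ?M True" for E
  proof
    assume F: "E \<in> ?M False"
    have P: "pairwise (\<lambda>d e. domino_cells d \<inter> domino_cells e = {}) E"
      using that by (auto simp: matchings_def)
    have "domino_cells (True, i, l) \<inter> domino_cells (False, i, l) = {}"
      by (rule pairwiseD[OF P]) (use that F in auto)
    then show False by simp
  qed
  then have "?M True \<inter> ?M False = {}" by blast
  then have "weight a S = (\<Sum>E\<in>?M True. a ^ card {e \<in> E. fst e}) + (\<Sum>E\<in>?M False. a ^ card {e \<in> E. fst e})"
    unfolding weight_def using U finite_matchings[OF S(1)]
    by (subst sum.union_disjoint[symmetric]) (auto intro: finite_subset)
  then show ?thesis
    unfolding sum_matchings_containing[OF S(1)] using S(2) by simp
qed

text \<open>The squares on the diagonals \<open>x + y = 2 t - 1 - N\<close> and \<open>x + y = 2 t - N\<close> (lower left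
  corners), numbered upwards.\<close>

definition even_cell :: "nat \<Rightarrow> nat \<Rightarrow> nat \<Rightarrow> int \<times> int" where
  "even_cell N t x = (int t - 1 - int x, int t + int x - int N)"

definition odd_cell :: "nat \<Rightarrow> nat \<Rightarrow> nat \<Rightarrow> int \<times> int" where
  "odd_cell N t x = (int t - int x, int t + int x - int N)"

lemma even_cell_inject: "even_cell N t x = even_cell N s y \<longleftrightarrow> t = s \<and> x = y"
  and odd_cell_inject: "odd_cell N t x = odd_cell N s y \<longleftrightarrow> t = s \<and> x = y"
  and even_odd_cell: "even_cell N t x \<noteq> odd_cell N s y"
  by (auto simp: even_cell_def odd_cell_def) presburger+

text \<open>\<open>R\<close> lies beyond the next even diagonal. The left and lower neighbours of a
  square on the odd diagonal lie on the preceding diagonal, which is already gone, so the squares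
  can be peeled one after another in the order of \<open>xs\<close>.\<close>

lemma weight_odd_step:
  assumes R: "finite R" "\<And>c. c \<in> R \<Longrightarrow> fst c + snd c > 2 * int t + 1 - int N"
  shows "distinct xs \<Longrightarrow> finite Q \<Longrightarrow>
    weight a (odd_cell N t ` set xs \<union> (even_cell N (Suc t) ` Q \<union> R)) =
    particle_sum a (\<lambda>Q. weight a (even_cell N (Suc t) ` Q \<union> R)) xs Q"
proof (induction xs arbitrary: Q)
  case Nil
  then show ?case by simp
next
  case (Cons x xs)
  let ?S = "odd_cell N t ` set (x # xs) \<union> (even_cell N (Suc t) ` Q \<union> R)"
  let ?i = "int t - int x" and ?l = "int t + int x - int N"
  have lev: "c \<in> ?S \<Longrightarrow> fst c + snd c \<ge> 2 * int t - int N" for c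
    using R(2)[of c] by (auto simp: odd_cell_def even_cell_def)
  have up: "(?i, ?l + 1) = even_cell N (Suc t) x" by (simp add: even_cell_def)
  have down: "x > 0 \<Longrightarrow> (?i + 1, ?l) = even_cell N (Suc t) (x - 1)" by (auto simp: even_cell_def)
  have even: "even_cell N (Suc t) y \<in> ?S \<longleftrightarrow> y \<in> Q" for y
    using R(2)[of "even_cell N (Suc t) y"]
    by (auto simp: even_cell_inject even_odd_cell image_iff) (auto simp: even_cell_def)
  \<comment> \<open>The right neighbour of square 0 would carry the number -1 on the next diagonal
    and is outside the region. Truncated subtraction would confuse it with square 0, hence the
    separate case.\<close>
  have down0: "(?i + 1, ?l) \<notin> ?S" if "x = 0"
    using that R(2)[of "(?i + 1, ?l)"] by (auto simp: even_cell_def odd_cell_def)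
  have here: "(?i, ?l) = odd_cell N t x" by (simp add: odd_cell_def)
  have oddR: "odd_cell N t y \<notin> R" for y
    using R(2)[of "odd_cell N t y"] by (auto simp: odd_cell_def)
  have evR: "even_cell N (Suc t) y \<notin> R" for y
    using R(2)[of "even_cell N (Suc t) y"] by (auto simp: even_cell_def)
  have rest: "?S - {odd_cell N t x, even_cell N (Suc t) y} =
      odd_cell N t ` set xs \<union> (even_cell N (Suc t) ` (Q - {y}) \<union> R)" for y
    using Cons.prems(1) oddR evR
    by (auto simp: odd_cell_inject even_cell_inject even_odd_cell even_odd_cell[symmetric])
  have "weight a ?S =
    (if (?i, ?l + 1) \<in> ?S then a * weight a (?S - {(?i, ?l), (?i, ?l + 1)}) else 0) +
    (if (?i + 1, ?l) \<in> ?S then weight a (?S - {(?i, ?l), (?i + 1, ?l)}) else 0)"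
  proof (rule weight_peel)
    show "(?i - 1, ?l) \<notin> ?S" by (intro notI) (drule lev, simp)
    show "(?i, ?l - 1) \<notin> ?S" by (intro notI) (drule lev, simp)
    show "(?i, ?l) \<in> ?S" unfolding here by simp
    show "finite ?S" using R Cons.prems by auto
  qed
  also have "\<dots> = (if x \<in> Q then a * weight a (odd_cell N t ` set xs \<union> (even_cell N (Suc t) ` (Q - {x}) \<union> R)) else 0) +
     (if 0 < x \<and> x - 1 \<in> Q then weight a (odd_cell N t ` set xs \<union> (even_cell N (Suc t) ` (Q - {x - 1}) \<union> R)) else 0)"
  proof (cases "x = 0")
    case True
    then show ?thesis unfolding up here even rest using down0 by auto
  next
    case False
    then have x: "x > 0" by simp
    show ?thesis unfolding up down[OF x] here even rest using x by auto
  qed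
  also have "\<dots> = particle_sum a (\<lambda>Q. weight a (even_cell N (Suc t) ` Q \<union> R)) (x # xs) Q"
    using Cons by simp
  finally show ?case .
qed

lemma weight_even_step:
  assumes R: "finite R" "\<And>c. c \<in> R \<Longrightarrow> fst c + snd c > 2 * int t - int N"
  shows "distinct xs \<Longrightarrow> finite Q \<Longrightarrow>
    weight a (even_cell N t ` set xs \<union> (odd_cell N t ` Q \<union> R)) =
    hole_sum a (\<lambda>Q. weight a (odd_cell N t ` Q \<union> R)) xs Q"
proof (induction xs arbitrary: Q)
  case Nil
  then show ?case by simp
next
  case (Cons x xs)
  let ?S = "even_cell N t ` set (x # xs) \<union> (odd_cell N t ` Q \<union> R)"
  let ?i = "int t - 1 - int x" and ?l = "int t + int x - int N"
  have lev: "c \<in> ?S \<Longrightarrow> fst c + snd c \<ge> 2 * int t - 1 - int N" for c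
    using R(2)[of c] by (auto simp: odd_cell_def even_cell_def)
  have up: "(?i, ?l + 1) = odd_cell N t (x + 1)" by (simp add: odd_cell_def)
  have down: "(?i + 1, ?l) = odd_cell N t x" by (auto simp: odd_cell_def)
  have odd: "odd_cell N t y \<in> ?S \<longleftrightarrow> y \<in> Q" for y
    using R(2)[of "odd_cell N t y"]
    by (auto simp: odd_cell_inject even_odd_cell even_odd_cell[symmetric] image_iff) (auto simp: odd_cell_def)
  have here: "(?i, ?l) = even_cell N t x" by (simp add: even_cell_def)
  have oddR: "odd_cell N t y \<notin> R" for y
    using R(2)[of "odd_cell N t y"] by (auto simp: odd_cell_def)
  have evR: "even_cell N t y \<notin> R" for y
    using R(2)[of "even_cell N t y"] by (auto simp: even_cell_def)
  have rest: "?S - {even_cell N t x, odd_cell N t y} =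
      even_cell N t ` set xs \<union> (odd_cell N t ` (Q - {y}) \<union> R)" for y
    using Cons.prems(1) oddR evR
    by (auto simp: odd_cell_inject even_cell_inject even_odd_cell even_odd_cell[symmetric])
  have "weight a ?S =
    (if (?i, ?l + 1) \<in> ?S then a * weight a (?S - {(?i, ?l), (?i, ?l + 1)}) else 0) +
    (if (?i + 1, ?l) \<in> ?S then weight a (?S - {(?i, ?l), (?i + 1, ?l)}) else 0)"
  proof (rule weight_peel)
    show "(?i - 1, ?l) \<notin> ?S" by (intro notI) (drule lev, simp)
    show "(?i, ?l - 1) \<notin> ?S" by (intro notI) (drule lev, simp)
    show "(?i, ?l) \<in> ?S" unfolding here by simp
    show "finite ?S" using R Cons.prems by auto
  qed
  also have "\<dots> = hole_sum a (\<lambda>Q. weight a (odd_cell N t ` Q \<union> R)) (x # xs) Q"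
    unfolding up down here odd rest using Cons by simp
  finally show ?case .
qed

section \<open>The cut-off diamond as a determinant\<close>

lemma sorted_wrt_less_distinct: "sorted_wrt (<) (xs :: nat list) \<Longrightarrow> distinct xs"
  by (simp add: strict_sorted_iff)

lemma sorted_wrt_less_unique:
  "sorted_wrt (<) (xs :: nat list) \<Longrightarrow> sorted_wrt (<) ys \<Longrightarrow> set xs = set ys \<Longrightarrow> xs = ys"
  by (simp add: strict_sorted_equal)

lemma sorted_wrt_less_full:
  assumes "sorted_wrt (<) (xs :: nat list)" "set xs \<subseteq> {..<n}" "length xs = n"
  shows "xs = [0..<n]"
proof (rule sorted_wrt_less_unique)
  have "card (set xs) = card {..<n}" using assms distinct_card[of xs] sorted_wrt_less_distinct by simp
  then show "set xs = set [0..<n]" using assms(2) by (simp add: card_subset_eq atLeast0LessThan)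
qed (use assms in auto)

context
  fixes N m n :: nat and a :: real
begin

text \<open>The diagonals left of the corner have full length; the remaining ones are cut off at the top,
  where \<open>n\<close> is the number of squares left on the even ones.\<close>

definition even_size :: "nat \<Rightarrow> nat" where "even_size t = (if t < m then N else n)"
definition odd_size :: "nat \<Rightarrow> nat" where "odd_size t = (if Suc t < m then Suc N else Suc n)"

definition after_odd :: "nat \<Rightarrow> (int \<times> int) set" where
  "after_odd t = (\<Union>s\<in>{t<..N}. even_cell N s ` {..<even_size s}) \<union>
    (\<Union>s\<in>{t<..<N}. odd_cell N s ` {..<odd_size s})"

definition after_even :: "nat \<Rightarrow> (int \<times> int) set" where
  "after_even t = (\<Union>s\<in>{t<..N}. even_cell N s ` {..<even_size s}) \<union>
    (\<Union>s\<in>{t..<N}. odd_cell N s ` {..<odd_size s})"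

definition aztec_cells :: "(int \<times> int) set" where
  "aztec_cells = (\<Union>s\<in>{..N}. even_cell N s ` {..<even_size s}) \<union>
    (\<Union>s\<in>{..<N}. odd_cell N s ` {..<odd_size s})"

text \<open>The argument is the set of squares still to be matched to the right: the holes here, but
  the particles in \<open>odd_amplitude\<close>. This is why even diagonals occur below with the
  complement of a particle list \<open>ys\<close>.\<close>

definition even_amplitude :: "nat \<Rightarrow> nat set \<Rightarrow> real" where
  "even_amplitude t P = weight a (even_cell N t ` P \<union> after_even t)"

definition odd_amplitude :: "nat \<Rightarrow> nat set \<Rightarrow> real" where
  "odd_amplitude t X = weight a (odd_cell N t ` X \<union> after_odd t)"

lemma weight_aztec_cells: "weight a aztec_cells = even_amplitude 0 {..<even_size 0}"
proof -
  have "{..N} = insert 0 {0<..N}" "{..<N} = {0..<N}" by auto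
  then have "aztec_cells = even_cell N 0 ` {..<even_size 0} \<union> after_even 0"
    unfolding aztec_cells_def after_even_def by auto
  then show ?thesis by (simp add: even_amplitude_def)
qed

lemma even_amplitude_step:
  assumes "t < N" "distinct xs"
  shows "even_amplitude t (set xs) = hole_sum a (odd_amplitude t) xs {..<odd_size t}"
proof -
  have "{t..<N} = insert t {t<..<N}" using assms by auto
  then have e: "after_even t = odd_cell N t ` {..<odd_size t} \<union> after_odd t"
    unfolding after_even_def after_odd_def by auto
  have "fst c + snd c > 2 * int t - int N" if "c \<in> after_odd t" for c
    using that by (auto simp: after_odd_def even_cell_def odd_cell_def)
  moreover have "finite (after_odd t)" by (auto simp: after_odd_def)
  ultimately show ?thesis
    unfolding even_amplitude_def e odd_amplitude_def
    by (intro weight_even_step) (use assms in auto)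
qed

lemma odd_amplitude_step:
  assumes "t < N" "distinct xs"
  shows "odd_amplitude t (set xs) = particle_sum a (even_amplitude (Suc t)) xs {..<even_size (Suc t)}"
proof -
  have "{t<..N} = insert (Suc t) {Suc t<..N}" "{t<..<N} = {Suc t..<N}" using assms by auto
  then have e: "after_odd t = even_cell N (Suc t) ` {..<even_size (Suc t)} \<union> after_even (Suc t)"
    unfolding after_even_def after_odd_def by auto
  have "fst c + snd c > 2 * int t + 1 - int N" if "c \<in> after_even (Suc t)" for c
    using that by (auto simp: after_even_def even_cell_def odd_cell_def)
  moreover have "finite (after_even (Suc t))" by (auto simp: after_even_def)
  ultimately show ?thesis
    unfolding even_amplitude_def e odd_amplitude_def
    by (intro weight_odd_step) (use assms in auto)
qed

section \<open>Recursion over the diagonals, first to the right and then to the left of the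
  corner\<close>

definition shifted :: "nat \<Rightarrow> nat \<Rightarrow> real fps" where
  "shifted M j = fps_X ^ j * (fps_const a + fps_X) ^ M"

text \<open>A step back over jumping particles multiplies every column by \<open>a + z\<close>. The
  vanishing condition at site \<open>n\<close> holds because the columns \<open>j < q\<close> have
  degree at most \<open>j + M < n\<close>.\<close>

lemma odd_amplitude_right:
  assumes IH: "\<And>ys. sorted_wrt (<) ys \<Longrightarrow> set ys \<subseteq> {..<n} \<Longrightarrow> length ys = q \<Longrightarrow>
      even_amplitude (Suc t) ({..<n} - set ys) = c * row_det q (map (\<lambda>y j. fps_nth (shifted M j) y) ys)"
    and t: "t < N" "m \<le> Suc t" and q: "q + M = n"
    and xs: "sorted_wrt (<) xs" "set xs \<subseteq> {..n}" "length xs = q"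
  shows "odd_amplitude t (set xs) = c * row_det q (map (\<lambda>x j. fps_nth (shifted (Suc M) j) x) xs)"
proof -
  interpret alternating_form "\<lambda>rs. c * row_det q rs" q by (rule alternating_form_row_det)
  have "odd_amplitude t (set xs) = particle_sum a (even_amplitude (Suc t)) xs ({..<n} - set [])"
    using odd_amplitude_step[OF t(1), of xs] xs t sorted_wrt_less_distinct by (simp add: even_size_def)
  also have "\<dots> = c * row_det q (map (\<lambda>y j. fps_nth (shifted M j) y) [] @ map (\<lambda>x j. fps_nth (shifted (Suc M) j) x) xs @ [])"
  proof (rule particle_sum_eq[where q = q], goal_cases)
    case (1 ys)
    then show ?case using IH[of ys] by simp
  next
    case (2 ys)
    have "row_det q (map (\<lambda>y j. fps_nth (shifted M j) y) ys @ [\<lambda>j. fps_nth (shifted M j) n]) = 0"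
      by (rule row_det_zero_row[where r = "\<lambda>j. fps_nth (shifted M j) n"])
        (use 2 q shifted_power_nth_zero[of _ M n a] in \<open>auto simp: shifted_def\<close>)
    then show ?case by simp
  next
    case (3 x)
    have e: "shifted (Suc M) j = shifted M j * (fps_const a + fps_X)" for j
      by (simp add: shifted_def mult_ac)
    show ?case unfolding e fps_nth_linear_mult by auto
  qed (use xs in auto)
  finally show ?thesis by simp
qed

text \<open>A step back over jumping holes creates a boundary row at \<open>n\<close>. To the right
  of the corner \<open>row_det_reduce\<close> eliminates it at once, which lowers the size by one
  and costs \<open>(1 + a\<^sup>2) ^ M\<close>.\<close>

lemma even_amplitude_right:
  assumes IH: "\<And>xs. sorted_wrt (<) xs \<Longrightarrow> set xs \<subseteq> {..n} \<Longrightarrow> length xs = Suc q \<Longrightarrow>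
      odd_amplitude t (set xs) = c * row_det (Suc q) (map (\<lambda>x j. fps_nth (shifted M j) x) xs)"
    and t: "t < N" "m \<le> t" and q: "q + M = n"
    and ys: "sorted_wrt (<) ys" "set ys \<subseteq> {..<n}" "length ys = q"
  shows "even_amplitude t ({..<n} - set ys) =
    c * (1 + a\<^sup>2) ^ M * row_det q (map (\<lambda>y j. fps_nth (shifted M j) y) ys)"
proof -
  interpret alternating_form "\<lambda>rs. c * row_det (Suc q) rs" "Suc q" by (rule alternating_form_row_det)
  let ?ps = "filter (\<lambda>p. p \<notin> set ys) [0..<n]"
  have "{..<n} - set ys = set ?ps" by auto
  then have "even_amplitude t ({..<n} - set ys) = even_amplitude t (set ?ps)" by simp
  also have "\<dots> = hole_sum a (odd_amplitude t) ?ps {..n}"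
    using even_amplitude_step[OF t(1), of ?ps] t by (simp add: odd_size_def lessThan_Suc_atMost)
  also have "\<dots> = c * row_det (Suc q) (map (partial a (\<lambda>x j. fps_nth (shifted M j) x) 0) ys @
      [partial a (\<lambda>x j. fps_nth (shifted M j) x) 0 n])"
    by (rule hole_sum_eq[where q = q]) (use IH ys in auto)
  also have "\<dots> = c * ((1 + a\<^sup>2) ^ M * row_det q (map (\<lambda>y j. fps_nth (shifted M j) y) ys))"
    unfolding partial_fps shifted_def using row_det_reduce[of ys q n M a] ys q by simp
  finally show ?thesis by simp
qed

text \<open>\<open>M\<close> counts the pairs of diagonals passed from the right end. On the last
  diagonal every square must be matched to the left, so \<open>ys\<close> is full and the
  determinant is that of the identity. The exponents \<open>1, ..., M\<close> add up to the
  triangular number.\<close>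

lemma right_part:
  assumes n: "N \<le> n + m" "m \<le> N"
  shows "M + m \<le> N \<Longrightarrow> sorted_wrt (<) ys \<Longrightarrow> set ys \<subseteq> {..<n} \<Longrightarrow> length ys = n - M \<Longrightarrow>
     even_amplitude (N - M) ({..<n} - set ys) =
       (1 + a\<^sup>2) ^ (M * (M + 1) div 2) * row_det (n - M) (map (\<lambda>y j. fps_nth (shifted M j) y) ys)"
proof (induction M arbitrary: ys)
  case 0
  have ys: "ys = [0..<n]" using sorted_wrt_less_full 0 by simp
  have "set ys = {..<n}" unfolding ys by auto
  then have "even_amplitude (N - 0) ({..<n} - set ys) = 1"
    by (simp add: even_amplitude_def after_even_def)
  moreover have "row_det n (map (\<lambda>y j. fps_nth (shifted 0 j) y) ys) = Determinant.det (1\<^sub>m n)"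
    unfolding row_det_def by (rule arg_cong[of _ _ Determinant.det], rule eq_matI) (auto simp: ys shifted_def fps_X_power_nth)
  ultimately show ?case by simp
next
  case (Suc M)
  let ?t = "N - Suc M"
  have t: "Suc ?t = N - M" "?t < N" "m \<le> ?t" using Suc.prems by auto
  have nM: "Suc M \<le> n" using Suc.prems n by simp
  then have q: "n - Suc M + Suc M = n" "Suc (n - Suc M) = n - M" by auto
  have odd: "odd_amplitude ?t (set xs) = (1 + a\<^sup>2) ^ (M * (M + 1) div 2) *
      row_det (Suc (n - Suc M)) (map (\<lambda>x j. fps_nth (shifted (Suc M) j) x) xs)"
    if "sorted_wrt (<) xs" "set xs \<subseteq> {..n}" "length xs = Suc (n - Suc M)" for xs
    by (rule odd_amplitude_right) (use Suc.IH t q that Suc.prems nM in auto)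
  have "even_amplitude ?t ({..<n} - set ys) = (1 + a\<^sup>2) ^ (M * (M + 1) div 2) * (1 + a\<^sup>2) ^ Suc M *
      row_det (n - Suc M) (map (\<lambda>y j. fps_nth (shifted (Suc M) j) y) ys)"
    by (rule even_amplitude_right) (use odd t q Suc.prems nM in auto)
  moreover have "Suc M * (Suc M + 1) div 2 = M * (M + 1) div 2 + Suc M"
    by simp
  ultimately show ?case by (simp only: power_add)
qed

text \<open>The first \<open>n + m - N\<close> columns come from \<open>right_part\<close> and one
  more particle step. The others are \<open>z ^ (n + 1), ..., z ^ N\<close>: unit columns that force
  artificial particles on the sites removed by the cut.\<close>

definition columns :: "nat \<Rightarrow> real fps" where
  "columns j = (if j < n + m - N then shifted (N - m + 1) j else fps_X ^ (j + N + 1 - m))"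

definition columns_at :: "nat \<Rightarrow> nat \<Rightarrow> real fps" where
  "columns_at s j = columns j * ((fps_const a + fps_X) * geometric a) ^ s"

fun boundary_rows :: "nat \<Rightarrow> (nat \<Rightarrow> real) list" where
  "boundary_rows 0 = []"
| "boundary_rows (Suc s) = (\<lambda>j. fps_nth (columns_at s j * geometric a) N) # boundary_rows s"

lemma length_boundary_rows [simp]: "length (boundary_rows s) = s"
  by (induction s) auto

lemma nth_boundary_rows: "i < s \<Longrightarrow> boundary_rows s ! i = (\<lambda>j. fps_nth (columns_at (s - 1 - i) j * geometric a) N)"
  by (induction s arbitrary: i) (auto simp: nth_Cons split: nat.splits)

text \<open>Holes of the full even diagonal \<open>m - 1\<close> cannot jump to the sites above
  \<open>n\<close>. This is the same as a full odd diagonal on which those sites must stay occupied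
  by particles, so the left part can work with \<open>N + 1\<close> sites throughout.\<close>

definition corner_amplitude :: "nat set \<Rightarrow> real" where
  "corner_amplitude X = (if {n<..N} \<subseteq> X then odd_amplitude (m - 1) (X - {n<..N}) else 0)"

lemma corner_amplitude_eq:
  assumes n: "N \<le> n + m" "1 \<le> m" "m \<le> N" "n \<le> N"
    and xs: "sorted_wrt (<) xs" "set xs \<subseteq> {..N}" "length xs = m"
  shows "corner_amplitude (set xs) = (1 + a\<^sup>2) ^ ((N - m) * (N - m + 1) div 2) *
     row_det m (map (\<lambda>x j. fps_nth (columns j) x) xs)"
proof (cases "{n<..N} \<subseteq> set xs")
  case False
  then obtain x where x: "n < x" "x \<le> N" "x \<notin> set xs"
    by (metis greaterThanAtMost_iff subsetI)
  \<comment> \<open>The index of the unit column \<open>z ^ x\<close>. No row belongs to site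
    \<open>x\<close>, so this column is zero.\<close>
  define j where "j = x + m - N - 1"
  have j: "j < m" "\<not> j < n + m - N" "j + N + 1 - m = x" using x n by (auto simp: j_def)
  have "row_det m (map (\<lambda>x j. fps_nth (columns j) x) xs) = 0"
    by (rule row_det_zero_column[of j]) (use j x xs in \<open>auto simp: columns_def fps_X_power_nth\<close>)
  then show ?thesis using False by (simp add: corner_amplitude_def)
next
  case True
  define p where "p = n + m - N"
  define ys where "ys = filter (\<lambda>x. x \<le> n) xs"
  have ys: "sorted_wrt (<) ys" "set ys = set xs - {n<..N}"
    using xs by (auto simp: ys_def sorted_wrt_filter)
  have "sorted_wrt (<) (ys @ [Suc n..<Suc N])"
    using ys(1) by (auto simp: sorted_wrt_append ys_def simp del: upt_Suc)
  moreover have "set xs = set (ys @ [Suc n..<Suc N])"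
    using True xs(2) by (auto simp: ys_def simp del: upt_Suc)
  ultimately have xs_eq: "xs = ys @ [Suc n..<Suc N]"
    using xs(1) by (intro sorted_wrt_less_unique)
  have len: "length ys = p" using arg_cong[OF xs_eq, of length] xs n by (simp add: p_def del: upt_Suc)
  have pm: "p + (N - n) = m" using n by (simp add: p_def)
  have Nm: "N - (N - m) = m" "Suc (m - 1) = m" using n by auto
  have even: "even_amplitude (Suc (m - 1)) ({..<n} - set ys) = (1 + a\<^sup>2) ^ ((N - m) * (N - m + 1) div 2) *
      row_det p (map (\<lambda>y j. fps_nth (shifted (N - m) j) y) ys)"
    if "sorted_wrt (<) ys" "set ys \<subseteq> {..<n}" "length ys = p" for ys
    using right_part[of "N - m" ys] that n unfolding Nm p_def by (simp add: Nm)
  have "corner_amplitude (set xs) = odd_amplitude (m - 1) (set ys)"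
    using True ys by (simp add: corner_amplitude_def)
  also have "\<dots> = (1 + a\<^sup>2) ^ ((N - m) * (N - m + 1) div 2) *
      row_det p (map (\<lambda>x j. fps_nth (shifted (Suc (N - m)) j) x) ys)"
    by (rule odd_amplitude_right) (use even ys len xs n in \<open>auto simp: p_def\<close>)
  also have "row_det p (map (\<lambda>x j. fps_nth (shifted (Suc (N - m)) j) x) ys) =
      row_det p (map (\<lambda>x j. fps_nth (columns j) x) ys)"
    unfolding row_det_def
    by (intro arg_cong[of _ _ Determinant.det] eq_matI) (auto simp: len columns_def p_def)
  also have "\<dots> = row_det (p + (N - n)) (map (\<lambda>x j. fps_nth (columns j) x) ys @
      map (\<lambda>x j. fps_nth (columns j) x) [Suc n..<Suc N])"
  proof (rule row_det_block[symmetric])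
    fix u j assume "u \<in> set (map (\<lambda>x j. fps_nth (columns j) x) ys)" "p \<le> j" "j < p + (N - n)"
    then obtain x where x: "x \<le> n" "u = (\<lambda>j. fps_nth (columns j) x)" "\<not> j < n + m - N" "j + N + 1 - m > n"
      using n by (auto simp: ys_def p_def)
    then show "u j = 0" by (simp add: columns_def fps_X_power_nth)
  next
    fix i j assume ij: "i < N - n" "j < N - n"
    have "p + j + N + 1 - m = Suc n + j" using n by (simp add: p_def)
    moreover have "map (\<lambda>x j. fps_nth (columns j) x) [Suc n..<Suc N] ! i = (\<lambda>j. fps_nth (columns j) (Suc n + i))"
      using ij by (simp del: upt_Suc)
    ultimately show "(map (\<lambda>x j. fps_nth (columns j) x) [Suc n..<Suc N] ! i) (p + j) = (if i = j then 1 else 0)"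
      using p_def by (simp add: columns_def fps_X_power_nth)
  qed (use len n in auto)
  also have "map (\<lambda>x j. fps_nth (columns j) x) ys @ map (\<lambda>x j. fps_nth (columns j) x) [Suc n..<Suc N] =
      map (\<lambda>x j. fps_nth (columns j) x) xs"
    using xs_eq by simp
  finally show ?thesis unfolding pm .
qed

text \<open>To the left of the corner the boundary rows are kept: each hole step trades one particle
  row for a boundary row, so the size remains \<open>m\<close>.\<close>

lemma even_amplitude_left:
  assumes IH: "\<And>xs. sorted_wrt (<) xs \<Longrightarrow> set xs \<subseteq> {..N} \<Longrightarrow> length xs = Suc t \<Longrightarrow>
      (if Suc t = m then corner_amplitude else odd_amplitude t) (set xs) =
        c * row_det m (map (\<lambda>x j. fps_nth (columns_at s j) x) xs @ boundary_rows s)"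
    and t: "Suc t + s = m" "m \<le> N" "n \<le> N"
    and ys: "sorted_wrt (<) ys" "set ys \<subseteq> {..<N}" "length ys = t"
  shows "even_amplitude t ({..<N} - set ys) =
    c * row_det m (map (\<lambda>y j. fps_nth (columns_at s j * geometric a) y) ys @ boundary_rows (Suc s))"
proof -
  interpret alternating_form "\<lambda>rs. c * row_det m rs" m by (rule alternating_form_row_det)
  let ?ps = "filter (\<lambda>p. p \<notin> set ys) [0..<N]"
  have "{..<N} - set ys = set ?ps" by auto
  then have "even_amplitude t ({..<N} - set ys) = even_amplitude t (set ?ps)" by simp
  also have "\<dots> = hole_sum a (odd_amplitude t) ?ps {..<odd_size t}"
    using even_amplitude_step[of t ?ps] t by simp
  also have "\<dots> = hole_sum a (if Suc t = m then corner_amplitude else odd_amplitude t) ?ps {..N}"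
  proof (cases "Suc t = m")
    case True
    have "{..N} - {n<..N} = {..<odd_size t}" "{n<..N} \<subseteq> {..N}" using t True by (auto simp: odd_size_def)
    then have "hole_sum a (\<lambda>Q. if {n<..N} \<subseteq> Q then odd_amplitude (m - 1) (Q - {n<..N}) else 0) ?ps {..N} =
      hole_sum a (odd_amplitude (m - 1)) ?ps {..<odd_size t}"
      unfolding hole_sum_occupied by simp
    moreover have "corner_amplitude = (\<lambda>Q. if {n<..N} \<subseteq> Q then odd_amplitude (m - 1) (Q - {n<..N}) else 0)"
      by (rule ext) (simp add: corner_amplitude_def)
    moreover have "m - 1 = t" using True by simp
    ultimately show ?thesis using True by simp
  next
    case False
    then show ?thesis using t by (simp add: odd_size_def lessThan_Suc_atMost)
  qed
  also have "\<dots> = c * row_det m (map (partial a (\<lambda>x j. fps_nth (columns_at s j) x) 0) ys @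
      partial a (\<lambda>x j. fps_nth (columns_at s j) x) 0 N # boundary_rows s)"
    by (rule hole_sum_eq[where q = t]) (use IH ys t in auto)
  finally show ?thesis unfolding partial_fps by simp
qed

lemma odd_amplitude_left:
  assumes IH: "\<And>ys. sorted_wrt (<) ys \<Longrightarrow> set ys \<subseteq> {..<N} \<Longrightarrow> length ys = Suc t \<Longrightarrow>
      even_amplitude (Suc t) ({..<N} - set ys) =
        c * row_det m (map (\<lambda>y j. fps_nth (columns_at s j * geometric a) y) ys @ boundary_rows (Suc s))"
    and t: "Suc (Suc t) + s = m" "m \<le> N"
    and xs: "sorted_wrt (<) xs" "set xs \<subseteq> {..N}" "length xs = Suc t"
  shows "odd_amplitude t (set xs) =
    c * row_det m (map (\<lambda>x j. fps_nth (columns_at (Suc s) j) x) xs @ boundary_rows (Suc s))"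
proof -
  interpret alternating_form "\<lambda>rs. c * row_det m rs" m by (rule alternating_form_row_det)
  have "odd_amplitude t (set xs) = particle_sum a (even_amplitude (Suc t)) xs ({..<N} - set [])"
    using odd_amplitude_step[of t xs] xs t sorted_wrt_less_distinct by (simp add: even_size_def)
  also have "\<dots> = c * row_det m (map (\<lambda>y j. fps_nth (columns_at s j * geometric a) y) [] @
      map (\<lambda>x j. fps_nth (columns_at (Suc s) j) x) xs @ boundary_rows (Suc s))"
  proof (rule particle_sum_eq[where q = "Suc t"], goal_cases)
    case (1 ys)
    then show ?case using IH[of ys] by simp
  next
    \<comment> \<open>The row of the missing site \<open>N\<close> equals the first row of
      \<open>boundary_rows (Suc s)\<close>, so the determinant has two equal rows.\<close>
    case (2 ys)
    show ?case using alternating[of "map (\<lambda>y j. fps_nth (columns_at s j * geometric a) y) ys" "[]" "boundary_rows s"] 2 t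
      by simp
  next
    case (3 x)
    have e: "columns_at (Suc s) j = columns_at s j * geometric a * (fps_const a + fps_X)" for j
      by (simp add: columns_at_def mult_ac)
    show ?case unfolding e fps_nth_linear_mult by auto
  qed (use xs t in auto)
  finally show ?thesis by simp
qed

lemma left_part:
  assumes n: "N \<le> n + m" "1 \<le> m" "m \<le> N" "n \<le> N"
  shows "Suc t + s = m \<Longrightarrow> sorted_wrt (<) ys \<Longrightarrow> set ys \<subseteq> {..<N} \<Longrightarrow> length ys = t \<Longrightarrow>
     even_amplitude t ({..<N} - set ys) = (1 + a\<^sup>2) ^ ((N - m) * (N - m + 1) div 2) *
       row_det m (map (\<lambda>y j. fps_nth (columns_at s j * geometric a) y) ys @ boundary_rows (Suc s))"
proof (induction s arbitrary: t ys)
  case 0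
  show ?case
    by (rule even_amplitude_left) (use 0 n corner_amplitude_eq in \<open>auto simp: columns_at_def\<close>)
next
  case (Suc s)
  show ?case
  proof (rule even_amplitude_left)
    fix xs :: "nat list" assume xs: "sorted_wrt (<) xs" "set xs \<subseteq> {..N}" "length xs = Suc t"
    have "odd_amplitude t (set xs) = (1 + a\<^sup>2) ^ ((N - m) * (N - m + 1) div 2) *
      row_det m (map (\<lambda>x j. fps_nth (columns_at (Suc s) j) x) xs @ boundary_rows (Suc s))"
      by (rule odd_amplitude_left) (use Suc n xs in auto)
    then show "(if Suc t = m then corner_amplitude else odd_amplitude t) (set xs) =
      (1 + a\<^sup>2) ^ ((N - m) * (N - m + 1) div 2) *
      row_det m (map (\<lambda>x j. fps_nth (columns_at (Suc s) j) x) xs @ boundary_rows (Suc s))"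
      using Suc.prems by simp
  qed (use Suc n in auto)
qed

text \<open>On the leftmost diagonal no particles are left, and the determinant consists of boundary
  rows only.\<close>

lemma weight_aztec_cells_det:
  assumes "N \<le> n + m" "1 \<le> m" "m \<le> N" "n \<le> N"
  shows "weight a aztec_cells = (1 + a\<^sup>2) ^ ((N - m) * (N - m + 1) div 2) * row_det m (boundary_rows m)"
  using left_part[OF assms, of 0 "m - 1" "[]"] assms by (simp add: weight_aztec_cells even_size_def)

end

text \<open>For \<open>n = N\<close> no diagonal is shortened, so the corner may be moved to
  \<open>m = 0\<close>. Then \<open>right_part\<close> with \<open>M = N\<close> covers the whole
  diamond and ends with the empty determinant.\<close>

lemma weight_full_aztec: "weight a (aztec_cells N m N) = (1 + a\<^sup>2) ^ (N * (N + 1) div 2)"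
proof -
  have "aztec_cells N m N = aztec_cells N 0 N"
    by (simp add: aztec_cells_def even_size_def odd_size_def)
  moreover have "row_det 0 [] = 1" by (simp add: row_det_def)
  ultimately show ?thesis
    using right_part[of N N 0 N "[]" a] weight_aztec_cells[of a N 0 N] by (simp add: even_size_def)
qed

section \<open>Pade approximants\<close>

text \<open>A multiple of the power has a convergent quotient at \<open>- a\<close>. Conversely, if
  the multiplicity \<open>k\<close> of the root were below \<open>m\<close>, the cofactor
  \<open>g\<close> would be bounded by a multiple of \<open>(z + a) ^ (m - k)\<close> and tend to 0,
  although \<open>g\<close> does not vanish at \<open>- a\<close>.\<close>

lemma poly_bigo_iff_dvd:
  fixes h :: "real poly"
  shows "(\<lambda>z. poly h z) \<in> O[at (- a)](\<lambda>z. (z + a) ^ m) \<longleftrightarrow> [:a, 1:] ^ m dvd h"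
proof
  assume "[:a, 1:] ^ m dvd h"
  then obtain g where g: "h = [:a, 1:] ^ m * g" by (elim dvdE)
  have ev: "eventually (\<lambda>z. z \<noteq> - a) (at (- a))" by (simp add: eventually_at_filter)
  have "((\<lambda>z. poly g z) \<longlongrightarrow> poly g (- a)) (at (- a))"
    by (intro isContD poly_isCont)
  then have "((\<lambda>z. poly h z / (z + a) ^ m) \<longlongrightarrow> poly g (- a)) (at (- a))"
    by (rule Lim_transform_eventually) (use ev in eventually_elim, auto simp: g add_eq_0_iff2 add.commute[of a])
  then show "(\<lambda>z. poly h z) \<in> O[at (- a)](\<lambda>z. (z + a) ^ m)"
    by (rule bigoI_tendsto) (use ev in eventually_elim, auto simp: add_eq_0_iff2)
next
  assume O: "(\<lambda>z. poly h z) \<in> O[at (- a)](\<lambda>z. (z + a) ^ m)"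
  show "[:a, 1:] ^ m dvd h"
  proof (cases "h = 0")
    case False
    define k where "k = order (- a) h"
    obtain g where g: "h = [:a, 1:] ^ k * g" "\<not> [:a, 1:] dvd g"
      using order_decomp[OF False, of "- a"] by (auto simp: k_def)
    then have g0: "poly g (- a) \<noteq> 0" using poly_eq_0_iff_dvd[of g "- a"] by simp
    have "m \<le> k"
    proof (rule ccontr)
      assume "\<not> m \<le> k"
      then have km: "k < m" by simp
      obtain C where C: "eventually (\<lambda>z. norm (poly h z) \<le> C * norm ((z + a) ^ m)) (at (- a))"
        using O by (auto elim: landau_o.bigE)
      have ev: "eventually (\<lambda>z. z \<noteq> - a) (at (- a))" by (simp add: eventually_at_filter)
      have "eventually (\<lambda>z. norm (poly g z) \<le> C * norm ((z + a) ^ (m - k))) (at (- a))"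
        using C ev
      proof eventually_elim
        case (elim z)
        have p: "norm ((z + a) ^ k) > 0" using elim by auto
        have "(z + a) ^ m = (z + a) ^ k * (z + a) ^ (m - k)" using km by (simp flip: power_add)
        then have "norm ((z + a) ^ k) * norm (poly g z) \<le> norm ((z + a) ^ k) * (C * norm ((z + a) ^ (m - k)))"
          using elim(1) g(1) by (simp add: abs_mult mult_ac add.commute)
        then show ?case using p by (simp only: mult_le_cancel_left_pos)
      qed
      moreover have "((\<lambda>z. C * norm ((z + a) ^ (m - k))) \<longlongrightarrow> C * norm ((- a + a) ^ (m - k))) (at (- a))"
        by (intro tendsto_intros)
      then have "((\<lambda>z. C * norm ((z + a) ^ (m - k))) \<longlongrightarrow> 0) (at (- a))" using km by (simp add: power_0_left)
      ultimately have "((\<lambda>z. poly g z) \<longlongrightarrow> 0) (at (- a))"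
        by (rule Lim_null_comparison)
      moreover have "((\<lambda>z. poly g z) \<longlongrightarrow> poly g (- a)) (at (- a))"
        by (intro isContD poly_isCont)
      ultimately have "poly g (- a) = 0" by (metis LIM_unique)
      then show False using g0 by simp
    qed
    then have "[:a, 1:] ^ m dvd [:a, 1:] ^ k" by (rule le_imp_power_dvd)
    then show ?thesis using g(1) by simp
  qed simp
qed

lemma is_pade_iff:
  "is_pade N m j a p q \<longleftrightarrow> degree p \<le> m - j \<and> degree q \<le> j - 1 \<and> coeff q 0 = 1 \<and>
     [:a, 1:] ^ m dvd p - monom 1 (m - j) * [:1, - a:] ^ (N - m + 1) * q"
proof -
  have "(\<lambda>z. poly p z - pade_target N m j a z * poly q z) =
      (\<lambda>z. poly (p - monom 1 (m - j) * [:1, - a:] ^ (N - m + 1) * q) z)"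
    by (rule ext) (simp add: pade_target_def poly_monom algebra_simps)
  then show ?thesis
    unfolding is_pade_def by (simp only: poly_bigo_iff_dvd poly_0_coeff_0)
qed

section \<open>Coefficient functionals that annihilate the multiples of
  \<open>(z + a) ^ m\<close>\<close>

definition pairing :: "nat \<Rightarrow> real fps \<Rightarrow> real poly \<Rightarrow> real" where
  "pairing N G h = (\<Sum>l\<le>N. coeff h l * (- 1) ^ l * fps_nth G l)"

lemma pairing_add: "pairing N G (p + q) = pairing N G p + pairing N G q"
  by (simp add: pairing_def sum.distrib algebra_simps)

lemma pairing_diff: "pairing N G (p - q) = pairing N G p - pairing N G q"
  by (simp add: pairing_def sum_subtractf algebra_simps)

lemma pairing_smult: "pairing N G (Polynomial.smult c p) = c * pairing N G p"
  by (simp add: pairing_def sum_distrib_left algebra_simps)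

lemma pairing_sum: "pairing N G (\<Sum>j\<in>S. f j) = (\<Sum>j\<in>S. pairing N G (f j))"
  by (induction S rule: infinite_finite_induct) (auto simp: pairing_add, auto simp: pairing_def)

lemma pairing_monom: "d \<le> N \<Longrightarrow> pairing N G (monom c d) = c * (- 1) ^ d * fps_nth G d"
  by (simp add: pairing_def if_distrib[of "\<lambda>x. x * _"] cong: if_cong)

text \<open>Reversing \<open>z \<mapsto> - 1 / z\<close> turns the coefficient functional into the pairing.\<close>

lemma pairing_shifted_power:
  "j + M + d = N \<Longrightarrow> fps_nth (fps_X ^ j * (fps_const a + fps_X) ^ M * G) N =
     (- 1) ^ d * pairing N G (monom 1 d * [:1, - a:] ^ M)"
proof (induction M arbitrary: j d)
  case 0
  then have "fps_nth (fps_X ^ j * G) N = fps_nth G d"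
    unfolding fps_X_power_mult_nth by auto
  then show ?case using 0 by (simp add: pairing_monom flip: mult.assoc power_add)
next
  case (Suc M)
  have "fps_X ^ j * (fps_const a + fps_X) ^ Suc M * G =
      fps_const a * (fps_X ^ j * (fps_const a + fps_X) ^ M * G) + fps_X ^ Suc j * (fps_const a + fps_X) ^ M * G"
    by (simp add: algebra_simps)
  then have "fps_nth (fps_X ^ j * (fps_const a + fps_X) ^ Suc M * G) N =
      a * fps_nth (fps_X ^ j * (fps_const a + fps_X) ^ M * G) N +
      fps_nth (fps_X ^ Suc j * (fps_const a + fps_X) ^ M * G) N"
    by simp
  also have "\<dots> = a * ((- 1) ^ Suc d * pairing N G (monom 1 (Suc d) * [:1, - a:] ^ M)) +
      (- 1) ^ d * pairing N G (monom 1 d * [:1, - a:] ^ M)"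
    using Suc.IH[of j "Suc d"] Suc.IH[of "Suc j" d] Suc.prems by simp
  also have "\<dots> = (- 1) ^ d * pairing N G (monom 1 d * [:1, - a:] ^ M - Polynomial.smult a (monom 1 (Suc d) * [:1, - a:] ^ M))"
    by (simp add: pairing_diff pairing_smult algebra_simps)
  also have "monom 1 d * [:1, - a:] ^ M - Polynomial.smult a (monom 1 (Suc d) * [:1, - a:] ^ M) = monom 1 d * [:1, - a:] ^ Suc M"
    by (simp add: monom_Suc algebra_simps)
  finally show ?case .
qed

text \<open>The substitution of \<open>- 1 / z\<close> turns \<open>a + z\<close> into
  \<open>- (1 - a z) / z\<close>, so each such factor of the polynomial moves to the series with a
  sign and an index shift. The degree bound ensures that the truncation at \<open>N\<close> loses
  nothing.\<close>

lemma pairing_mult_linear_power: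
  "degree h + i \<le> N \<Longrightarrow> pairing N G (h * [:a, 1:] ^ i) =
     (- 1) ^ i * (\<Sum>l\<le>N - i. coeff h l * (- 1) ^ l * fps_nth ((1 - fps_const a * fps_X) ^ i * G) (l + i))"
proof (induction i arbitrary: h)
  case 0
  then show ?case by (simp add: pairing_def)
next
  case (Suc i)
  define D where "D = (1 - fps_const a * fps_X) ^ i * G"
  define c where "c l = (- 1) ^ l * fps_nth D (l + i)" for l
  have D: "fps_nth ((1 - fps_const a * fps_X) * D) (Suc l) = fps_nth D (Suc l) - a * fps_nth D l" for l
    by (simp add: left_diff_distrib mult.assoc)
  obtain K where K: "N - i = Suc K" using Suc.prems by (metis Suc_diff_Suc add_leD2 Suc_le_eq)
  have hK: "coeff h (Suc K) = 0" using Suc.prems K by (intro coeff_eq_0) linarith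
  have "degree (h * [:a, 1:]) \<le> degree h + 1"
    using degree_mult_le[of h "[:a, 1:]"] by simp
  then have "pairing N G ((h * [:a, 1:]) * [:a, 1:] ^ i) =
      (- 1) ^ i * (\<Sum>l\<le>Suc K. coeff (h * [:a, 1:]) l * c l)"
    using Suc.IH[of "h * [:a, 1:]"] Suc.prems K by (simp add: c_def D_def mult.assoc)
  also have "(\<Sum>l\<le>Suc K. coeff (h * [:a, 1:]) l * c l) =
      (\<Sum>l\<le>Suc K. coeff (Polynomial.smult a h + pCons 0 h) l * c l)"
    by simp
  also have "\<dots> = (\<Sum>l\<le>Suc K. a * coeff h l * c l) + (\<Sum>l\<le>Suc K. coeff (pCons 0 h) l * c l)"
    by (simp add: sum.distrib distrib_right)
  also have "(\<Sum>l\<le>Suc K. coeff (pCons 0 h) l * c l) = (\<Sum>l\<le>K. coeff h l * c (Suc l))"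
    by (subst sum.atMost_Suc_shift) simp
  also have "(\<Sum>l\<le>Suc K. a * coeff h l * c l) = (\<Sum>l\<le>K. a * coeff h l * c l)" using hK by simp
  also have "(\<Sum>l\<le>K. a * coeff h l * c l) + (\<Sum>l\<le>K. coeff h l * c (Suc l)) =
      (\<Sum>l\<le>K. - (coeff h l * (- 1) ^ l * fps_nth ((1 - fps_const a * fps_X) * D) (Suc (l + i))))"
    unfolding sum.distrib[symmetric] D by (intro sum.cong refl) (simp add: c_def algebra_simps)
  also have "\<dots> = - (\<Sum>l\<le>K. coeff h l * (- 1) ^ l * fps_nth ((1 - fps_const a * fps_X) * D) (l + Suc i))"
    by (simp add: sum_negf)
  also have "(1 - fps_const a * fps_X) * D = (1 - fps_const a * fps_X) ^ Suc i * G"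
    by (simp add: D_def mult.assoc)
  also have "K = N - Suc i" using K by simp
  finally have *: "pairing N G ((h * [:a, 1:]) * [:a, 1:] ^ i) = (- 1) ^ i *
      - (\<Sum>l\<le>N - Suc i. coeff h l * (- 1) ^ l * fps_nth ((1 - fps_const a * fps_X) ^ Suc i * G) (l + Suc i))" .
  have "h * [:a, 1:] ^ Suc i = (h * [:a, 1:]) * [:a, 1:] ^ i"
    by (simp only: power_Suc mult.assoc)
  then show ?case
    unfolding * by (simp only: * power_Suc mult_minus_left mult_minus_right mult_1_left)
qed

definition boundary_series :: "real \<Rightarrow> nat \<Rightarrow> real fps" where
  "boundary_series a s = ((fps_const a + fps_X) * geometric a) ^ s * geometric a"

lemma linear_powers_nth_zero:
  "x > s + r \<Longrightarrow> fps_nth ((fps_const a + fps_X) ^ s * (1 - fps_const (a :: real) * fps_X) ^ r) x = 0"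
proof (induction r arbitrary: x)
  case 0
  then show ?case using linear_power_nth_zero by simp
next
  case (Suc r)
  define E where "E = (fps_const a + fps_X) ^ s * (1 - fps_const a * fps_X) ^ r"
  have e: "(fps_const a + fps_X) ^ s * (1 - fps_const a * fps_X) ^ Suc r = E - fps_const a * (fps_X * E)"
    by (simp add: E_def algebra_simps)
  show ?case unfolding e using Suc.IH[of x] Suc.IH[of "x - 1"] Suc.prems by (simp flip: E_def)
qed

text \<open>The series has denominator \<open>(1 - a z) ^ (s + 1)\<close>. Moving
  \<open>(z + a) ^ m\<close> over clears it and leaves a polynomial of degree at most
  \<open>m - 1\<close>, whereas only coefficients of index at least \<open>m\<close> are
  read.\<close>

lemma pairing_boundary_series_dvd:
  assumes "s < m" "[:a, 1:] ^ m dvd h" "degree h \<le> N"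
  shows "pairing N (boundary_series a s) h = 0"
proof (cases "h = 0")
  case True
  then show ?thesis by (simp add: pairing_def)
next
  case False
  obtain g where g: "h = g * [:a, 1:] ^ m" using assms(2) by (metis dvdE mult.commute)
  have "g \<noteq> 0" using False g by auto
  then have "degree g + m \<le> N"
    using assms(3) unfolding g by (simp add: degree_mult_eq degree_power_eq)
  then have "pairing N (boundary_series a s) h =
     (- 1) ^ m * (\<Sum>l\<le>N - m. coeff g l * (- 1) ^ l * fps_nth ((1 - fps_const a * fps_X) ^ m * boundary_series a s) (l + m))"
    unfolding g by (rule pairing_mult_linear_power)
  also have "(1 - fps_const a * fps_X) ^ m * boundary_series a s =
      (fps_const a + fps_X) ^ s * (1 - fps_const a * fps_X) ^ (m - 1 - s)"
  proof -
    have "m = Suc s + (m - 1 - s)" using assms(1) by simp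
    then have "(1 - fps_const a * fps_X) ^ m = (1 - fps_const a * fps_X) ^ Suc s * (1 - fps_const a * fps_X) ^ (m - 1 - s)"
      by (metis power_add)
    then have "(1 - fps_const a * fps_X) ^ m * boundary_series a s =
       (fps_const a + fps_X) ^ s * (1 - fps_const a * fps_X) ^ (m - 1 - s) * ((1 - fps_const a * fps_X) * geometric a) ^ Suc s"
      by (simp add: boundary_series_def power_mult_distrib mult_ac)
    then show ?thesis by (simp add: geometric_inverse)
  qed
  also have "(\<Sum>l\<le>N - m. coeff g l * (- 1) ^ l *
      fps_nth ((fps_const a + fps_X) ^ s * (1 - fps_const a * fps_X) ^ (m - 1 - s)) (l + m)) = 0"
    by (intro sum.neutral ballI) (use assms(1) in \<open>simp add: linear_powers_nth_zero\<close>)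
  finally show ?thesis by simp
qed

text \<open>Either alternative for \<open>v\<close> makes the matrix triangular.\<close>

lemma det_replace_column:
  fixes v :: "nat \<Rightarrow> real"
  assumes c: "c < m" and v: "(\<forall>i. c < i \<longrightarrow> v i = 0) \<or> (\<forall>i<c. v i = 0)"
  shows "Determinant.det (Matrix.mat m m (\<lambda>(i, j). if j = c then v i else if i = j then 1 else 0)) = v c"
    (is "Determinant.det ?A = _")
proof -
  have "Determinant.det ?A = prod_list (diag_mat ?A)"
    using v
  proof
    assume "\<forall>i. c < i \<longrightarrow> v i = 0"
    then show ?thesis by (intro det_upper_triangular[of _ m]) (auto simp: upper_triangular_def)
  next
    assume "\<forall>i<c. v i = 0"
    then show ?thesis by (intro det_lower_triangular[of m]) auto
  qed
  also have "diag_mat ?A = map (\<lambda>i. if i = c then v i else 1) [0..<m]"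
    unfolding diag_mat_def by (rule map_cong) auto
  also have "prod_list \<dots> = (\<Prod>i\<in>set [0..<m]. if i = c then v i else 1)"
    by (rule prod.distinct_set_conv_list[symmetric]) simp
  also have "\<dots> = v c" using c by simp
  finally show ?thesis .
qed

lemma sum_replace_column:
  fixes B v :: "nat \<Rightarrow> real"
  assumes "c < m"
  shows "(\<Sum>l\<in>{0..<m}. B l * (if j = c then v l else if l = j then 1 else 0)) =
    (if j = c then \<Sum>l<m. B l * v l else if j < m then B j else (0 :: real))"
proof (cases "j = c")
  case True
  then show ?thesis by (simp add: atLeast0LessThan)
next
  case False
  then have "(\<Sum>l\<in>{0..<m}. B l * (if j = c then v l else if l = j then 1 else 0)) =
      (\<Sum>l\<in>{0..<m}. if l = j then B l else 0)"
    by (intro sum.cong) auto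
  then show ?thesis using False by simp
qed

section \<open>The linear system of the Pade approximant and its determinant\<close>

context
  fixes N m :: nat and a :: real
begin

text \<open>The reversed \<open>columns\<close> for \<open>n = N + k - m - 1\<close>. Index
  \<open>j\<close> corresponds to the Pade index \<open>j + 1\<close>, since matrix columns are
  counted from 0; the signs of the reversal are put into \<open>pade_matrix\<close>.\<close>

definition pade_column :: "nat \<Rightarrow> nat \<Rightarrow> real poly" where
  "pade_column k j = monom 1 (m - 1 - j) * (if Suc j < k then [:1, - a:] ^ (N - m + 1) else 1)"

definition pade_matrix :: "nat \<Rightarrow> real mat" where
  "pade_matrix k = Matrix.mat m m (\<lambda>(i, j). (- 1) ^ (m - 1 - j) * pairing N (boundary_series a (m - 1 - i)) (pade_column k j))"

abbreviation "\<Lambda> i \<equiv> pairing N (boundary_series a (m - 1 - i))"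

lemma pade_matrix_carrier: "pade_matrix k \<in> carrier_mat m m"
  by (simp add: pade_matrix_def)

lemma pade_matrix_combination:
  "i < m \<Longrightarrow> (\<Sum>j<m. pade_matrix k $$ (i, j) * v j) = \<Lambda> i (\<Sum>j<m. Polynomial.smult ((- 1) ^ (m - 1 - j) * v j) (pade_column k j))"
  by (simp add: pairing_sum pairing_smult pade_matrix_def mult_ac)

lemma pade_matrix_kernel:
  assumes "Determinant.det (pade_matrix k) \<noteq> 0" "\<And>i. i < m \<Longrightarrow> (\<Sum>j<m. pade_matrix k $$ (i, j) * v j) = 0" "j < m"
  shows "v j = 0"
proof -
  have "pade_matrix k *\<^sub>v Matrix.vec m v = 0\<^sub>v m"
    by (rule eq_vecI) (use assms(2) in \<open>auto simp: scalar_prod_def pade_matrix_def lessThan_atLeast0\<close>)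
  moreover have "Matrix.vec m v \<in> carrier_vec m" by simp
  ultimately have "Matrix.vec m v = 0\<^sub>v m"
    using det_0_iff_vec_prod_zero_field[OF pade_matrix_carrier, of k] assms(1) by metis
  then show ?thesis using assms(3) by (metis index_vec index_zero_vec(1))
qed

lemma pade_matrix_solve:
  assumes "Determinant.det (pade_matrix k) \<noteq> 0"
  obtains v where "\<And>i. i < m \<Longrightarrow> (\<Sum>j<m. pade_matrix k $$ (i, j) * v j) = b i"
proof -
  obtain C where C: "C \<in> carrier_mat m m" "pade_matrix k * C = 1\<^sub>m m"
    using det_non_zero_imp_unit[OF pade_matrix_carrier assms]
    by (auto simp: Units_def ring_mat_def)
  define w where "w = C *\<^sub>v Matrix.vec m b"
  have w: "w \<in> carrier_vec m" using C by (auto simp: w_def)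
  have "pade_matrix k *\<^sub>v w = (pade_matrix k * C) *\<^sub>v Matrix.vec m b"
    unfolding w_def using C pade_matrix_carrier by (intro assoc_mult_mat_vec[symmetric]) auto
  then have e: "pade_matrix k *\<^sub>v w = Matrix.vec m b" using C by simp
  have "(\<Sum>j<m. pade_matrix k $$ (i, j) * vec_index w j) = b i" if "i < m" for i
  proof -
    have "vec_index (pade_matrix k *\<^sub>v w) i = b i" using e that by simp
    then show ?thesis using that w pade_matrix_carrier[of k]
      by (auto simp: scalar_prod_def lessThan_atLeast0)
  qed
  then show ?thesis by (rule that)
qed

text \<open>For \<open>k = 1\<close> the columns are the monomials of degree below \<open>m\<close>,
  so the nonzero determinant says that the functionals separate residues modulo
  \<open>(z + a) ^ m\<close>. A polynomial and its remainder have the same pairings.\<close>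

lemma pairing_zero_imp_dvd:
  assumes "Determinant.det (pade_matrix 1) \<noteq> 0" "m \<le> N" "degree h \<le> N" "\<And>i. i < m \<Longrightarrow> \<Lambda> i h = 0"
  shows "[:a, 1:] ^ m dvd h"
proof -
  let ?d = "[:a, 1:] ^ m"
  define r where "r = h mod ?d"
  have d: "?d \<noteq> 0" "degree ?d = m" by (simp_all add: degree_power_eq)
  have deg: "degree r < m \<or> r = 0" using degree_mod_less[OF d(1), of h] d(2) by (auto simp: r_def)
  have high: "coeff r l = 0" if "m \<le> l" for l
    using deg that by (cases "r = 0") (auto intro: coeff_eq_0)
  have "degree (h - r) \<le> N" using deg assms(2,3) by (intro degree_diff_le) auto
  moreover have "?d dvd h - r" by (simp add: r_def minus_mod_eq_mult_div)
  ultimately have "\<Lambda> i (h - r) = 0" if "i < m" for i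
    using that by (intro pairing_boundary_series_dvd[of _ m]) auto
  then have r0: "\<Lambda> i r = 0" if "i < m" for i using that assms(4) by (simp add: pairing_diff)
  have r: "(\<Sum>j<m. Polynomial.smult ((- 1) ^ (m - 1 - j) * ((- 1) ^ (m - 1 - j) * coeff r (m - 1 - j))) (pade_column 1 j)) = r"
  proof -
    have "(\<Sum>j<m. Polynomial.smult ((- 1) ^ (m - 1 - j) * ((- 1) ^ (m - 1 - j) * coeff r (m - 1 - j))) (pade_column 1 j)) =
      (\<Sum>j<m. monom (coeff r (m - 1 - j)) (m - 1 - j))"
      by (intro sum.cong refl) (simp add: pade_column_def smult_monom flip: mult.assoc power_add)
    also have "\<dots> = (\<Sum>l<m. monom (coeff r l) l)"
      using sum.nat_diff_reindex[of "\<lambda>l. monom (coeff r l) l" m] by simp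
    also have "\<dots> = r"
      by (intro poly_eqI) (auto simp: coeff_sum not_less high)
    finally show ?thesis .
  qed
  have "(- 1) ^ (m - 1 - j) * coeff r (m - 1 - j) = 0" if "j < m" for j
    by (rule pade_matrix_kernel[OF assms(1) _ that, of "\<lambda>j. (- 1) ^ (m - 1 - j) * coeff r (m - 1 - j)"])
      (unfold pade_matrix_combination r, rule r0)
  then have "coeff r (m - 1 - j) = 0" if "j < m" for j using that by fastforce
  then have "coeff r l = 0" for l
  proof (cases "l < m")
    case True
    then show ?thesis using \<open>\<And>j. j < m \<Longrightarrow> coeff r (m - 1 - j) = 0\<close>[of "m - 1 - l"] by simp
  next
    case False
    then show ?thesis using high by simp
  qed
  then have "r = 0" by (intro poly_eqI) simp
  then show ?thesis by (simp add: r_def dvd_eq_mod_eq_0)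
qed

text \<open>With \<open>f = z ^ (m - k) * (1 - a z) ^ (N - m + 1)\<close>, the first
  \<open>k - 1\<close> columns are \<open>f * z ^ e\<close> with \<open>1 <= e < k\<close> and the
  others are \<open>z ^ e\<close> with \<open>e <= m - k\<close>. Their combinations are thus
  \<open>f * (q - q(0)) + p\<close> in the Pade degrees.\<close>

lemma sum_pade_column:
  assumes k: "1 \<le> k" "k \<le> m"
  shows "(\<Sum>j<m. Polynomial.smult (if Suc j < k then u (k - 1 - j) else v (m - 1 - j)) (pade_column k j)) =
     monom 1 (m - k) * [:1, - a:] ^ (N - m + 1) * (\<Sum>e=1..<k. monom (u e) e) + (\<Sum>e\<le>m - k. monom (v e) e)"
proof -
  let ?f = "monom 1 (m - k) * [:1, - a:] ^ (N - m + 1)"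
  let ?g = "\<lambda>j. Polynomial.smult (if Suc j < k then u (k - 1 - j) else v (m - 1 - j)) (pade_column k j)"
  have "{..<m} = {..<k - 1} \<union> {k - 1..<m}" using k by auto
  then have "(\<Sum>j<m. ?g j) = (\<Sum>j\<in>{..<k - 1} \<union> {k - 1..<m}. ?g j)" by (simp only:)
  also have "\<dots> = (\<Sum>j<k - 1. ?g j) + (\<Sum>j=k - 1..<m. ?g j)"
    by (rule sum.union_disjoint) auto
  also have "(\<Sum>j<k - 1. ?g j) = (\<Sum>j<k - 1. ?f * monom (u (k - 1 - j)) (k - 1 - j))"
  proof (rule sum.cong[OF refl])
    fix j assume j: "j \<in> {..<k - 1}"
    then have "m - 1 - j = (m - k) + (k - 1 - j)" using k by auto
    then have "Polynomial.smult (u (k - 1 - j)) (monom 1 (m - 1 - j)) = monom 1 (m - k) * monom (u (k - 1 - j)) (k - 1 - j)"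
      by (simp add: mult_monom smult_monom)
    then have "Polynomial.smult (u (k - 1 - j)) (monom 1 (m - 1 - j)) * [:1, - a:] ^ (N - m + 1) =
        ?f * monom (u (k - 1 - j)) (k - 1 - j)"
      by (simp only: mult_ac)
    then show "?g j = ?f * monom (u (k - 1 - j)) (k - 1 - j)"
      using j by (simp add: pade_column_def less_diff_conv)
  qed
  also have "\<dots> = ?f * (\<Sum>j<k - 1. monom (u (k - 1 - j)) (k - 1 - j))"
    by (rule sum_distrib_left[symmetric])
  also have "(\<Sum>j<k - 1. monom (u (k - 1 - j)) (k - 1 - j)) = (\<Sum>e=1..<k. monom (u e) e)"
    by (rule sum.reindex_bij_witness[of _ "\<lambda>e. k - 1 - e" "\<lambda>j. k - 1 - j"]) auto
  also have "(\<Sum>j=k - 1..<m. ?g j) = (\<Sum>j=k - 1..<m. monom (v (m - 1 - j)) (m - 1 - j))"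
    by (intro sum.cong refl) (auto simp: pade_column_def smult_monom)
  also have "\<dots> = (\<Sum>e\<le>m - k. monom (v e) e)"
    by (rule sum.reindex_bij_witness[of _ "\<lambda>e. m - 1 - e" "\<lambda>j. m - 1 - j"]) (use k in auto)
  finally show ?thesis .
qed

lemma sum_monom_degree_le: "degree p \<le> n \<Longrightarrow> (\<Sum>e\<le>n. monom (coeff p e) e) = (p :: real poly)"
  by (intro poly_eqI) (auto simp: coeff_sum not_le intro!: coeff_eq_0)

lemma sum_monom_tail:
  assumes "degree q \<le> k - 1" "1 \<le> k"
  shows "(\<Sum>e=1..<k. monom (coeff q e) e) = (q :: real poly) - [:coeff q 0:]"
proof -
  have "{..k - 1} = insert 0 {1..<k}" using assms(2) by auto
  then have "(\<Sum>e\<le>k - 1. monom (coeff q e) e) = [:coeff q 0:] + (\<Sum>e=1..<k. monom (coeff q e) e)"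
    by (simp add: monom_0)
  then show ?thesis using sum_monom_degree_le[OF assms(1)] by (simp add: algebra_simps)
qed

text \<open>The degree bounds add up to exactly \<open>N\<close>, the truncation index of the
  pairing.\<close>

lemma degree_pade_residual:
  assumes "1 \<le> k" "k \<le> m" "m \<le> N" "degree p \<le> m - k" "degree q \<le> k - 1"
  shows "degree (p - monom 1 (m - k) * [:1, - a:] ^ (N - m + 1) * q) \<le> N"
proof -
  have "degree (monom (1 :: real) (m - k) * [:1, - a:] ^ (N - m + 1) * q) \<le> (m - k) + (N - m + 1) + (k - 1)"
    by (intro order.trans[OF degree_mult_le] add_mono degree_monom_le assms
        order.trans[OF degree_power_le]) auto
  then show ?thesis using assms by (intro degree_diff_le) auto
qed

text \<open>The difference \<open>Q\<close> of two denominators has no constant term, so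
  \<open>P - f * Q\<close> is a combination of the columns of \<open>pade_matrix k\<close>. All
  functionals kill it, hence its coordinates vanish.\<close>

lemma pade_unique:
  assumes k: "1 \<le> k" "k \<le> m" "m \<le> N" and det: "Determinant.det (pade_matrix k) \<noteq> 0"
    and pq: "is_pade N m k a p q" "is_pade N m k a p' q'"
  shows "p = p' \<and> q = q'"
proof -
  define P where "P = p - p'"
  define Q where "Q = q - q'"
  let ?f = "monom 1 (m - k) * [:1, - a:] ^ (N - m + 1)"
  have deg: "degree P \<le> m - k" "degree Q \<le> k - 1" and Q0: "coeff Q 0 = 0"
    using pq unfolding is_pade_iff P_def Q_def by (auto intro: degree_diff_le)
  have "[:a, 1:] ^ m dvd (p - ?f * q) - (p' - ?f * q')"
    using pq unfolding is_pade_iff by (blast intro: dvd_diff)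
  also have "(p - ?f * q) - (p' - ?f * q') = P - ?f * Q" by (simp add: P_def Q_def algebra_simps smult_diff_right)
  finally have "[:a, 1:] ^ m dvd P - ?f * Q" .
  then have L0: "\<Lambda> i (P - ?f * Q) = 0" if "i < m" for i
    using degree_pade_residual[OF k deg] that by (intro pairing_boundary_series_dvd[of _ m]) auto
  define w where "w j = (if Suc j < k then - coeff Q (k - 1 - j) else coeff P (m - 1 - j))" for j
  have "(\<Sum>j<m. Polynomial.smult (w j) (pade_column k j)) =
     ?f * (\<Sum>e=1..<k. monom (- coeff Q e) e) + (\<Sum>e\<le>m - k. monom (coeff P e) e)"
    unfolding w_def using k(1,2) by (rule sum_pade_column)
  also have "(\<Sum>e=1..<k. monom (- coeff Q e) e) = - Q"
    using sum_monom_tail[OF deg(2) k(1)] Q0 by (simp add: sum_negf flip: minus_monom)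
  also have "(\<Sum>e\<le>m - k. monom (coeff P e) e) = P" by (rule sum_monom_degree_le[OF deg(1)])
  finally have W: "(\<Sum>j<m. Polynomial.smult ((- 1) ^ (m - 1 - j) * ((- 1) ^ (m - 1 - j) * w j)) (pade_column k j)) = P - ?f * Q"
    by (simp flip: mult.assoc power_add)
  have "(- 1) ^ (m - 1 - j) * w j = 0" if "j < m" for j
    by (rule pade_matrix_kernel[OF det _ that, of "\<lambda>j. (- 1) ^ (m - 1 - j) * w j"])
      (unfold pade_matrix_combination W, rule L0)
  then have w0: "w j = 0" if "j < m" for j using that by fastforce
  have "coeff P e = 0" for e
  proof (cases "e \<le> m - k")
    case True
    then show ?thesis using w0[of "m - 1 - e"] k by (simp add: w_def split: if_splits)
  next
    case False
    then show ?thesis using deg by (intro coeff_eq_0) auto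
  qed
  then have "P = 0" by (intro poly_eqI) simp
  moreover have "coeff Q e = 0" for e
  proof (cases "e < k")
    case True
    show ?thesis
    proof (cases "e = 0")
      case False
      then have "Suc (k - 1 - e) < k" "k - 1 - (k - 1 - e) = e" "k - 1 - e < m" using True k by auto
      then show ?thesis using w0[of "k - 1 - e"] by (simp only: w_def if_True neg_equal_0_iff_equal)
    qed (use Q0 in simp)
  next
    case False
    then show ?thesis using deg k by (intro coeff_eq_0) auto
  qed
  then have "Q = 0" by (intro poly_eqI) simp
  ultimately show ?thesis by (simp add: P_def Q_def)
qed

text \<open>The system is solved so that \<open>f * (1 - q) + p\<close> has the same pairings as
  \<open>f\<close>. The residual \<open>p - f * q\<close> then has zero pairings, and
  \<open>det1\<close> upgrades this to divisibility.\<close>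

lemma pade_exists:
  assumes k: "1 \<le> k" "k \<le> m" "m \<le> N" and det: "Determinant.det (pade_matrix k) \<noteq> 0"
    and det1: "Determinant.det (pade_matrix 1) \<noteq> 0"
  obtains p q where "is_pade N m k a p q"
proof -
  let ?f = "monom 1 (m - k) * [:1, - a:] ^ (N - m + 1)"
  obtain v where v: "\<And>i. i < m \<Longrightarrow> (\<Sum>j<m. pade_matrix k $$ (i, j) * v j) = \<Lambda> i ?f"
    using pade_matrix_solve[OF det, of "\<lambda>i. \<Lambda> i ?f"] by metis
  define w where "w j = (- 1) ^ (m - 1 - j) * v j" for j
  define p where "p = (\<Sum>e\<le>m - k. monom (w (m - 1 - e)) e)"
  define q where "q = 1 - (\<Sum>e=1..<k. monom (w (k - 1 - e)) e)"
  have "(\<Sum>j<m. Polynomial.smult (w j) (pade_column k j)) =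
      (\<Sum>j<m. Polynomial.smult (if Suc j < k then w (k - 1 - (k - 1 - j)) else w (m - 1 - (m - 1 - j))) (pade_column k j))"
    by (intro sum.cong refl) auto
  also have "\<dots> = ?f * (\<Sum>e=1..<k. monom (w (k - 1 - e)) e) + (\<Sum>e\<le>m - k. monom (w (m - 1 - e)) e)"
    using k(1,2) by (rule sum_pade_column)
  also have "\<dots> = ?f * (1 - q) + p" by (simp add: p_def q_def)
  finally have W: "(\<Sum>j<m. Polynomial.smult (w j) (pade_column k j)) = ?f * (1 - q) + p" .
  have "\<Lambda> i (?f * (1 - q) + p) = \<Lambda> i ?f" if "i < m" for i
    using v[OF that] unfolding pade_matrix_combination[OF that] w_def[symmetric] W .
  moreover have "F * (1 - q) + p = F + (p - F * q)" for F by (simp add: algebra_simps)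
  ultimately have L: "\<Lambda> i (p - ?f * q) = 0" if "i < m" for i
    using that by (metis add_cancel_left_right pairing_add)
  have deg: "degree p \<le> m - k" "degree q \<le> k - 1"
  proof -
    show "degree p \<le> m - k" unfolding p_def
      by (intro degree_sum_le) (auto intro: order.trans[OF degree_monom_le])
    show "degree q \<le> k - 1" unfolding q_def
      by (intro degree_diff_le degree_sum_le) (auto intro: order.trans[OF degree_monom_le])
  qed
  have "[:a, 1:] ^ m dvd p - ?f * q"
    by (rule pairing_zero_imp_dvd[OF det1 k(3) degree_pade_residual[OF k deg] L])
  moreover have "coeff q 0 = 1" by (simp add: q_def coeff_sum)
  ultimately show ?thesis using that deg unfolding is_pade_iff by blast
qed

text \<open>The two matrices differ only in column \<open>k - 1\<close>, which stems from
  \<open>f\<close> in one and from \<open>z ^ (m - k)\<close> in the other. The congruence of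
  \<open>p\<close> and \<open>f * q\<close> gives one vector that combines the columns of either,
  with coefficients \<open>q(0) = 1\<close> and \<open>coeff p (m - k)\<close> at that column up to
  a common sign. Putting the vector there makes the matrices equal.\<close>

lemma det_pade_matrix_Suc:
  assumes k: "1 \<le> k" "k \<le> m" "m \<le> N" and pq: "is_pade N m k a p q"
  shows "Determinant.det (pade_matrix (Suc k)) = coeff p (m - k) * Determinant.det (pade_matrix k)"
proof -
  let ?f = "monom 1 (m - k) * [:1, - a:] ^ (N - m + 1)"
  let ?c = "k - 1"
  have deg: "degree p \<le> m - k" "degree q \<le> k - 1" and q0: "coeff q 0 = 1"
    and dvd: "[:a, 1:] ^ m dvd p - ?f * q"
    using pq unfolding is_pade_iff by auto
  have L0: "\<Lambda> i p = \<Lambda> i (?f * q)" if "i < m" for i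
  proof -
    have "\<Lambda> i (p - ?f * q) = 0"
      using degree_pade_residual[OF k deg] dvd that by (intro pairing_boundary_series_dvd[of _ m]) auto
    then show ?thesis by (simp add: pairing_diff)
  qed
  \<comment> \<open>\<open>u\<close> and \<open>w\<close> are the coordinates of
    \<open>f * q\<close> and \<open>p\<close>, with the signs of \<open>pade_matrix\<close> undone.
    \<open>u\<close> ends and \<open>w\<close> starts at index \<open>k - 1\<close>, so
    \<open>U\<close> and \<open>W\<close> are triangular.\<close>
  define u where "u j = (- 1) ^ (m - 1 - j) * (if j < k then coeff q (k - 1 - j) else 0)" for j
  define w where "w j = (- 1) ^ (m - 1 - j) * (if Suc j < k then 0 else coeff p (m - 1 - j))" for j
  have colw: "(\<Sum>j<m. pade_matrix k $$ (i, j) * w j) = \<Lambda> i p" if "i < m" for i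
  proof -
    have "(\<Sum>j<m. Polynomial.smult ((- 1) ^ (m - 1 - j) * w j) (pade_column k j)) =
      (\<Sum>j<m. Polynomial.smult (if Suc j < k then 0 else coeff p (m - 1 - j)) (pade_column k j))"
      unfolding w_def by (simp flip: mult.assoc power_add)
    also have "\<dots> = ?f * (\<Sum>e=1..<k. monom 0 e) + (\<Sum>e\<le>m - k. monom (coeff p e) e)"
      using k(1,2) by (rule sum_pade_column)
    also have "\<dots> = p" using sum_monom_degree_le[OF deg(1)] by simp
    finally show ?thesis using pade_matrix_combination[OF that] by simp
  qed
  have colu: "(\<Sum>j<m. pade_matrix (Suc k) $$ (i, j) * u j) = \<Lambda> i (?f * q)" if "i < m" for i
  proof -
    have "(\<Sum>j<m. Polynomial.smult ((- 1) ^ (m - 1 - j) * u j) (pade_column (Suc k) j)) =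
      (\<Sum>j<m. Polynomial.smult (if j < k then coeff q (k - 1 - j) else 0) (pade_column (Suc k) j))"
      unfolding u_def by (simp flip: mult.assoc power_add)
    also have "\<dots> = (\<Sum>j<m. if j = ?c then ?f else Polynomial.smult (if Suc j < k then coeff q (k - 1 - j) else 0) (pade_column k j)) "
    proof (rule sum.cong[OF refl])
      fix j
      consider "j = ?c" | "Suc j < k" | "k \<le> j" by linarith
      then show "Polynomial.smult (if j < k then coeff q (k - 1 - j) else 0) (pade_column (Suc k) j) =
        (if j = ?c then ?f else Polynomial.smult (if Suc j < k then coeff q (k - 1 - j) else 0) (pade_column k j))"
        by cases (use k q0 in \<open>auto simp: pade_column_def\<close>)
    qed
    also have "\<dots> = (\<Sum>j<m. (if j = ?c then ?f else 0) +
        Polynomial.smult (if Suc j < k then coeff q (k - 1 - j) else 0) (pade_column k j))"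
      by (intro sum.cong refl) (use k in auto)
    also have "\<dots> = ?f + (?f * (\<Sum>e=1..<k. monom (coeff q e) e) + (\<Sum>e\<le>m - k. monom 0 e))"
      unfolding sum.distrib sum_pade_column[OF k(1,2), of "coeff q" "\<lambda>_. 0", symmetric] using k by simp
    also have "\<dots> = ?f * q"
      unfolding sum_monom_tail[OF deg(2) k(1)] using q0 by (simp add: algebra_simps smult_diff_right)
    finally show ?thesis using pade_matrix_combination[OF that] by simp
  qed
  define U where "U = Matrix.mat m m (\<lambda>(i, j). if j = ?c then u i else if i = j then 1 else 0)"
  define W where "W = Matrix.mat m m (\<lambda>(i, j). if j = ?c then w i else if i = j then 1 else 0)"
  have c: "?c < m" using k by auto
  have UW: "U \<in> carrier_mat m m" "W \<in> carrier_mat m m" by (auto simp: U_def W_def)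
  have "pade_matrix (Suc k) * U = pade_matrix k * W"
  proof (rule eq_matI)
    fix i j assume "i < dim_row (pade_matrix k * W)" "j < dim_col (pade_matrix k * W)"
    then have ij: "i < m" "j < m" using UW pade_matrix_carrier[of k] by auto
    have "(pade_matrix (Suc k) * U) $$ (i, j) =
      (\<Sum>l\<in>{0..<m}. pade_matrix (Suc k) $$ (i, l) * (if j = ?c then u l else if l = j then 1 else 0))"
      using ij pade_matrix_carrier[of "Suc k"] by (auto simp: U_def scalar_prod_def)
    also have "\<dots> = (if j = ?c then \<Lambda> i (?f * q) else pade_matrix (Suc k) $$ (i, j))"
      unfolding sum_replace_column[OF c] using ij colu by simp
    also have "\<dots> = (if j = ?c then \<Lambda> i p else pade_matrix k $$ (i, j))"
      using L0[OF ij(1)] ij by (auto simp: pade_matrix_def pade_column_def)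
    also have "\<dots> = (\<Sum>l\<in>{0..<m}. pade_matrix k $$ (i, l) * (if j = ?c then w l else if l = j then 1 else 0))"
      unfolding sum_replace_column[OF c] using ij colw by simp
    also have "\<dots> = (pade_matrix k * W) $$ (i, j)"
      using ij pade_matrix_carrier[of k] by (auto simp: W_def scalar_prod_def)
    finally show "(pade_matrix (Suc k) * U) $$ (i, j) = (pade_matrix k * W) $$ (i, j)" .
  qed (use UW pade_matrix_carrier[of k] pade_matrix_carrier[of "Suc k"] in auto)
  then have "Determinant.det (pade_matrix (Suc k)) * Determinant.det U = Determinant.det (pade_matrix k) * Determinant.det W"
    using UW pade_matrix_carrier by (simp flip: det_mult[of _ m])
  moreover have "Determinant.det U = (- 1) ^ (m - k)"
    unfolding U_def using k q0 by (subst det_replace_column[OF c]) (auto simp: u_def)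
  moreover have "Determinant.det W = (- 1) ^ (m - k) * coeff p (m - k)"
    unfolding W_def using k by (subst det_replace_column[OF c]) (auto simp: w_def)
  ultimately show ?thesis by simp
qed

lemma det_pade_matrix_Suc_kappa:
  assumes k: "1 \<le> k" "k \<le> m" "m \<le> N"
    and det: "Determinant.det (pade_matrix k) \<noteq> 0" "Determinant.det (pade_matrix 1) \<noteq> 0"
  shows "Determinant.det (pade_matrix (Suc k)) = kappa N m k a * Determinant.det (pade_matrix k)"
proof -
  obtain p q where pq: "is_pade N m k a p q" using pade_exists[OF k det] by blast
  have "pade_pair N m k a = (p, q)"
    unfolding pade_pair_def using pq pade_unique[OF k det(1)] by (intro the_equality) (auto split: prod.splits)
  then show ?thesis using det_pade_matrix_Suc[OF k pq] by (simp add: kappa_def)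
qed

end

section \<open>Domino tilings of the plane region\<close>

definition domino_rect :: "bool \<times> int \<times> int \<Rightarrow> (real \<times> real) set" where
  "domino_rect = (\<lambda>(v, i, l). {of_int i .. of_int i + (if v then 1 else 2)} \<times>
     {of_int l .. of_int l + (if v then 2 else 1)})"

lemma domino_rect_eq: "domino_rect d = (\<Union>(i, l)\<in>domino_cells d. unit_square i l)"
proof -
  obtain v i l where d: "d = (v, i, l)" by (cases d) auto
  have split: "{x..x + 2} = {x..x + 1} \<union> {x + 1..x + 1 + 1}" for x :: real by auto
  show ?thesis
    unfolding d domino_rect_def unit_square_def
    by (cases v) (simp_all only: split prod.case if_True if_False domino_cells.simps UN_insert UN_empty
        Times_Un_distrib1 Sigma_Un_distrib2 Un_empty_right of_int_add of_int_1)
qed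

text \<open>Closed squares share boundary points, but the center of a cell lies in no other unit
  square. It therefore recovers a set of cells from the region they cover.\<close>

definition center :: "int \<times> int \<Rightarrow> real \<times> real" where
  "center c = (of_int (fst c) + 1 / 2, of_int (snd c) + 1 / 2)"

lemma half_between_iff: "of_int i \<le> of_int j + (1 / 2 :: real) \<and> of_int j + (1 / 2 :: real) \<le> of_int i + 1 \<longleftrightarrow> i = j"
  by linarith

lemma center_in_unit_square: "center c \<in> unit_square i l \<longleftrightarrow> c = (i, l)"
  by (cases c) (auto simp: center_def unit_square_def half_between_iff)

lemma center_in_Union: "center c \<in> (\<Union>(i, l)\<in>C. unit_square i l) \<longleftrightarrow> c \<in> C"
  by (auto simp: center_in_unit_square)

lemma Union_squares_inject:
  "(\<Union>(i, l)\<in>A. unit_square i l) = (\<Union>(i, l)\<in>C. unit_square i l) \<longleftrightarrow> A = C"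
proof
  assume e: "(\<Union>(i, l)\<in>A. unit_square i l) = (\<Union>(i, l)\<in>C. unit_square i l)"
  have "c \<in> A \<longleftrightarrow> c \<in> C" for c
    using center_in_Union[of c A] center_in_Union[of c C] e by simp
  then show "A = C" by blast
qed simp

lemma center_in_domino_rect: "center c \<in> domino_rect d \<longleftrightarrow> c \<in> domino_cells d"
  unfolding domino_rect_eq by (rule center_in_Union)

lemma domino_rect_subset_iff:
  "domino_rect d \<subseteq> (\<Union>(i, l)\<in>C. unit_square i l) \<longleftrightarrow> domino_cells d \<subseteq> C"
proof
  assume *: "domino_rect d \<subseteq> (\<Union>(i, l)\<in>C. unit_square i l)"
  show "domino_cells d \<subseteq> C"
  proof
    fix c assume "c \<in> domino_cells d"
    then have "center c \<in> (\<Union>(i, l)\<in>C. unit_square i l)" using * center_in_domino_rect by blast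
    then show "c \<in> C" unfolding center_in_Union .
  qed
qed (auto simp: domino_rect_eq)

lemma domino_rect_inject: "domino_rect d = domino_rect e \<longleftrightarrow> d = e"
proof
  assume "domino_rect d = domino_rect e"
  then have "domino_cells d = domino_cells e"
    using center_in_domino_rect by blast
  then show "d = e"
    by (cases d; cases e) (auto simp: doubleton_eq_iff split: if_splits)
qed simp

lemma interior_domino_rect:
  "interior (domino_rect (v, i, l)) = {of_int i <..< of_int i + (if v then 1 else 2)} \<times>
     {of_int l <..< of_int l + (if v then 2 else 1)}"
  by (simp add: domino_rect_def interior_Times)

lemma interior_domino_rect_disjoint:
  "interior (domino_rect d) \<inter> interior (domino_rect e) = {} \<longleftrightarrow> domino_cells d \<inter> domino_cells e = {}"
proof
  assume *: "interior (domino_rect d) \<inter> interior (domino_rect e) = {}"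
  have "center c \<in> interior (domino_rect f)" if "c \<in> domino_cells f" for c f
    using that by (cases f) (auto simp: interior_domino_rect center_def)
  then show "domino_cells d \<inter> domino_cells e = {}" using * by blast
next
  assume *: "domino_cells d \<inter> domino_cells e = {}"
  obtain v i l w i' l' where d: "d = (v, i, l)" "e = (w, i', l')" by (cases d; cases e) auto
  show "interior (domino_rect d) \<inter> interior (domino_rect e) = {}"
  proof (rule ccontr)
    assume "interior (domino_rect d) \<inter> interior (domino_rect e) \<noteq> {}"
    then obtain x y :: real where
      "of_int i < x" "x < of_int i + (if v then 1 else 2)" "of_int i' < x" "x < of_int i' + (if w then 1 else 2)"
      "of_int l < y" "y < of_int l + (if v then 2 else 1)" "of_int l' < y" "y < of_int l' + (if w then 2 else 1)"
      unfolding d interior_domino_rect by auto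
    then have "i < i' + (if w then 1 else 2)" "i' < i + (if v then 1 else 2)"
      "l < l' + (if w then 2 else 1)" "l' < l + (if v then 2 else 1)"
      by (auto split: if_splits)
    \<comment> \<open>The overlap of the two rectangles has this point as its lower left corner,
      which makes it a common cell.\<close>
    then have "(max i i', max l l') \<in> domino_cells d \<inter> domino_cells e"
      unfolding d by (auto split: if_splits simp: max_def)
    then show False using * by blast
  qed
qed

lemma vertical_domino_iff: "vertical_domino (domino_rect d) \<longleftrightarrow> fst d"
proof -
  have "vertical_domino D \<longleftrightarrow> (\<exists>i l. D = domino_rect (True, i, l))" for D
    by (simp add: vertical_domino_def domino_rect_def)
  then show ?thesis by (cases d) (auto simp: domino_rect_inject)
qed

lemma domino_iff_range: "vertical_domino D \<or> horizontal_domino D \<longleftrightarrow> D \<in> range domino_rect"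
proof -
  have "D \<in> range domino_rect \<longleftrightarrow> (\<exists>i l. D = domino_rect (True, i, l)) \<or> (\<exists>i l. D = domino_rect (False, i, l))"
    by (auto simp: image_iff) (metis (full_types))
  then show ?thesis
    by (simp add: vertical_domino_def horizontal_domino_def domino_rect_def)
qed

lemma tiling_iff_matching:
  "domino_tiling (\<Union>(i, l)\<in>C. unit_square i l) (domino_rect ` E) \<longleftrightarrow> E \<in> matchings C"
proof -
  let ?R = "\<Union>(i, l)\<in>C. unit_square i l"
  have inside: "(\<forall>D\<in>domino_rect ` E. (vertical_domino D \<or> horizontal_domino D) \<and> D \<subseteq> ?R) \<longleftrightarrow>
      (\<forall>d\<in>E. domino_cells d \<subseteq> C)"
    unfolding domino_iff_range by (simp add: domino_rect_subset_iff)
  have disj: "pairwise (\<lambda>D F. interior D \<inter> interior F = {}) (domino_rect ` E) \<longleftrightarrow>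
      pairwise (\<lambda>d e. domino_cells d \<inter> domino_cells e = {}) E"
    by (simp add: pairwise_image domino_rect_inject interior_domino_rect_disjoint) (simp add: pairwise_def)
  have cover: "\<Union>(domino_rect ` E) = ?R \<longleftrightarrow> C \<subseteq> \<Union>(domino_cells ` E)"
    if sub: "\<forall>d\<in>E. domino_cells d \<subseteq> C"
  proof -
    have "\<Union>(domino_rect ` E) = (\<Union>(i, l)\<in>\<Union>(domino_cells ` E). unit_square i l)"
      by (simp add: domino_rect_eq)
    also have "\<dots> = ?R \<longleftrightarrow> \<Union>(domino_cells ` E) = C"
      by (rule Union_squares_inject)
    also have "\<dots> \<longleftrightarrow> C \<subseteq> \<Union>(domino_cells ` E)" using sub by blast
    finally show ?thesis .
  qed
  have "domino_tiling ?R (domino_rect ` E) \<longleftrightarrow> (\<forall>d\<in>E. domino_cells d \<subseteq> C) \<and>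
      pairwise (\<lambda>d e. domino_cells d \<inter> domino_cells e = {}) E \<and> \<Union>(domino_rect ` E) = ?R"
    unfolding domino_tiling_def by (simp only: inside disj)
  then show ?thesis
    unfolding matchings_def mem_Collect_eq using cover by (simp only: cong: conj_cong)
qed

lemma sum_tilings:
  "(\<Sum>T\<in>tilings (\<Union>(i, l)\<in>C. unit_square i l). a ^ num_vertical T) = weight a C"
proof -
  have T: "tilings (\<Union>(i, l)\<in>C. unit_square i l) = (\<lambda>E. domino_rect ` E) ` matchings C"
  proof (intro equalityI subsetI)
    fix T assume "T \<in> tilings (\<Union>(i, l)\<in>C. unit_square i l)"
    then have T: "domino_tiling (\<Union>(i, l)\<in>C. unit_square i l) T" by (simp add: tilings_def)
    then have "T \<subseteq> range domino_rect" by (auto simp: domino_tiling_def domino_iff_range)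
    then obtain E where "T = domino_rect ` E" by (auto simp: subset_image_iff)
    then show "T \<in> (\<lambda>E. domino_rect ` E) ` matchings C" using T tiling_iff_matching by blast
  qed (auto simp: tilings_def tiling_iff_matching)
  have inj: "inj domino_rect" by (auto simp: inj_def domino_rect_inject)
  have "num_vertical (domino_rect ` E) = card {d \<in> E. fst d}" for E
  proof -
    have "{D \<in> domino_rect ` E. vertical_domino D} = domino_rect ` {d \<in> E. fst d}"
      by (auto simp: vertical_domino_iff)
    then show ?thesis unfolding num_vertical_def
      using inj by (simp add: card_image inj_on_subset)
  qed
  moreover have "inj_on (\<lambda>E. domino_rect ` E) (matchings C)"
    using inj by (intro inj_on_image) (auto intro: inj_on_subset)
  ultimately show ?thesis
    unfolding T weight_def by (simp add: sum.reindex)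
qed

section \<open>The cut-off diamond as a set of lattice cells\<close>

definition diamond_cells :: "nat \<Rightarrow> nat \<Rightarrow> nat \<Rightarrow> (int \<times> int) set" where
  "diamond_cells N m k = {(i, l). i + l + 1 \<le> int N \<and> - i - l \<le> int N + 1 \<and> i - l \<le> int N \<and> l - i \<le> int N \<and>
     (i + l + 3 + int N \<le> 2 * int m \<or> l - i + 2 + 2 * int m \<le> int N + 2 * int k)}"

lemma unit_square_subset_bound_iff:
  "unit_square i l \<subseteq> reduced_aztec_bound N m k \<longleftrightarrow> (i, l) \<in> diamond_cells N m k"
proof
  assume sub: "unit_square i l \<subseteq> reduced_aztec_bound N m k"
  have in_bound: "(of_int i + s, of_int l + t) \<in> reduced_aztec_bound N m k"
    if "0 \<le> s" "s \<le> 1" "0 \<le> t" "t \<le> 1" for s t :: real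
    using sub that by (auto simp: unit_square_def)
  have "of_int i + of_int l + 2 \<le> real N + 1" using in_bound[of 1 1] by (auto simp: reduced_aztec_bound_def)
  moreover have "- of_int i - of_int l \<le> real N + 1" using in_bound[of 0 0] by (auto simp: reduced_aztec_bound_def)
  moreover have "of_int i + 1 - of_int l \<le> real N + 1" using in_bound[of 1 0] by (auto simp: reduced_aztec_bound_def)
  moreover have "of_int l + 1 - of_int i \<le> real N + 1" using in_bound[of 0 1] by (auto simp: reduced_aztec_bound_def)
  \<comment> \<open>The two lines of the cut meet at the integer abscissa
    \<open>2 m - N - k\<close>, so a unit square lies below a single one of them. The midpoint of
    its upper edge tells which, and integrality gains the remaining \<open>1 / 2\<close>.\<close>
  moreover have "of_int l + 1 \<le> 2 * real m - 1 - real N - (of_int i + 1 / 2) \<or>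
      of_int l + 1 \<le> of_int i + 1 / 2 - 2 * real m - 1 + real N + 2 * real k"
    using in_bound[of "1 / 2" 1] by (auto simp: reduced_aztec_bound_def max_def split: if_splits)
  ultimately show "(i, l) \<in> diamond_cells N m k"
    unfolding diamond_cells_def by auto
next
  assume "(i, l) \<in> diamond_cells N m k"
  then have D: "of_int i + of_int l + 1 \<le> real N" "- of_int i - of_int l \<le> real N + 1"
      "of_int i - of_int l \<le> real N" "of_int l - of_int i \<le> real N"
      "of_int i + of_int l + 3 + real N \<le> 2 * real m \<or>
       of_int l - of_int i + 2 + 2 * real m \<le> real N + 2 * real k"
    unfolding diamond_cells_def by auto
  show "unit_square i l \<subseteq> reduced_aztec_bound N m k"
  proof
    fix z assume "z \<in> unit_square i l"
    then obtain x y where z: "z = (x, y)" and xy: "of_int i \<le> x" "x \<le> of_int i + 1" "of_int l \<le> y" "y \<le> of_int l + 1"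
      by (auto simp: unit_square_def)
    have "x + y \<le> real N + 1" using D(1) xy by simp
    moreover have "- x - y \<le> real N + 1" using D(2) xy by simp
    moreover have "x - y \<le> real N + 1" using D(3) xy by simp
    moreover have "y - x \<le> real N + 1" using D(4) xy by simp
    ultimately have "\<bar>x\<bar> + \<bar>y\<bar> \<le> real N + 1" by (simp add: abs_if)
    moreover have "y \<le> 2 * real m - 1 - real N - x \<or> y \<le> x - 2 * real m - 1 + real N + 2 * real k"
      using D(5)
    proof
      assume "of_int i + of_int l + 3 + real N \<le> 2 * real m"
      then have "y \<le> 2 * real m - 1 - real N - x" using xy by simp
      then show ?thesis ..
    next
      assume "of_int l - of_int i + 2 + 2 * real m \<le> real N + 2 * real k"
      then have "y \<le> x - 2 * real m - 1 + real N + 2 * real k" using xy by simp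
      then show ?thesis ..
    qed
    ultimately show "z \<in> reduced_aztec_bound N m k"
      unfolding z reduced_aztec_bound_def by (simp add: le_max_iff_disj)
  qed
qed

lemma reduced_aztec_eq: "reduced_aztec N m k = (\<Union>(i, l)\<in>diamond_cells N m k. unit_square i l)"
proof -
  have "{S. \<exists>i l. S = unit_square i l \<and> S \<subseteq> reduced_aztec_bound N m k} =
      (\<lambda>(i, l). unit_square i l) ` diamond_cells N m k"
    (is "?A = ?B")
  proof (intro equalityI subsetI)
    fix S assume "S \<in> ?A"
    then obtain i l where "S = unit_square i l" "(i, l) \<in> diamond_cells N m k"
      using unit_square_subset_bound_iff by blast
    then show "S \<in> ?B" by (intro image_eqI[of _ _ "(i, l)"]) auto
  next
    fix S assume "S \<in> ?B"
    then obtain i l where "S = unit_square i l" "(i, l) \<in> diamond_cells N m k" by auto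
    then show "S \<in> ?A" using unit_square_subset_bound_iff by blast
  qed
  then show ?thesis unfolding reduced_aztec_def by simp
qed

lemma gen_fun_eq_weight: "gen_fun N m k a = weight a (diamond_cells N m k)"
  unfolding gen_fun_def reduced_aztec_eq by (rule sum_tilings)

text \<open>The parity of \<open>i + l + int N\<close> decides the kind of diagonal: even values
  belong to \<open>odd_cell\<close>, odd values to \<open>even_cell\<close>.\<close>

lemma diamond_cells_eq:
  assumes "1 \<le> m" "m \<le> N" "1 \<le> k" "k \<le> m + 1"
  shows "diamond_cells N m k = aztec_cells N m (N + k - m - 1)"
proof (intro equalityI subsetI)
  fix c assume c: "c \<in> diamond_cells N m k"
  obtain i l where il: "c = (i, l)" by (cases c)
  note C = c[unfolded il diamond_cells_def, simplified]
  show "c \<in> aztec_cells N m (N + k - m - 1)"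
  proof (cases "even (i + l + int N)")
    case True
    then obtain s where s: "i + l + int N = 2 * s" by (elim evenE)
    have "c = odd_cell N (nat s) (nat (s - i))" "nat s < N"
      "nat (s - i) < odd_size N m (N + k - m - 1) (nat s)"
      using C s assms unfolding il odd_cell_def odd_size_def by (auto split: if_splits)
    then show ?thesis unfolding aztec_cells_def by auto
  next
    case False
    then have "even (i + l + int N + 1)" by simp
    then obtain s where s: "i + l + int N + 1 = 2 * s" by (elim evenE)
    have "c = even_cell N (nat s) (nat (s - 1 - i))" "nat s \<le> N"
      "nat (s - 1 - i) < even_size N m (N + k - m - 1) (nat s)"
      using C s assms unfolding il even_cell_def even_size_def by (auto split: if_splits)
    then show ?thesis unfolding aztec_cells_def by auto
  qed
next
  fix c assume "c \<in> aztec_cells N m (N + k - m - 1)"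
  then consider s x where "s \<le> N" "x < even_size N m (N + k - m - 1) s" "c = even_cell N s x"
    | s x where "s < N" "x < odd_size N m (N + k - m - 1) s" "c = odd_cell N s x"
    unfolding aztec_cells_def by auto
  then show "c \<in> diamond_cells N m k"
    by cases (use assms in \<open>auto simp: diamond_cells_def even_cell_def odd_cell_def even_size_def odd_size_def split: if_splits\<close>)
qed

lemma finite_aztec_cells: "finite (aztec_cells N m n)"
  by (simp add: aztec_cells_def)

text \<open>Tiling every row of squares horizontally shows that the region has a tiling at all.\<close>

lemma weight_diamond_cells_pos:
  assumes "1 \<le> m" "m \<le> N" "1 \<le> k" "k \<le> m + 1" "0 < a"
  shows "0 < weight a (diamond_cells N m k)"
proof -
  let ?C = "diamond_cells N m k"
  \<comment> \<open>Left ends of the dominoes. The leftmost square of an uncut row has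
    \<open>i + l + N = 2 l\<close> for \<open>l >= 0\<close> and \<open>i + l + N = - 1\<close> for
    \<open>l < 0\<close>. The cut respects this parity: it only meets rows with
    \<open>l >= 0\<close>, and there the right piece starts at
    \<open>i + l + N = 2 (l + 1 + m - k)\<close>.\<close>
  define start where "start i l \<longleftrightarrow> (0 \<le> l \<longleftrightarrow> even (i + l + int N))" for i l
  have start_shift: "start (i + 1) l \<longleftrightarrow> \<not> start i l" for i l
    by (auto simp: start_def)
  define E where "E = {(False, i, l) | i l. (i, l) \<in> ?C \<and> start i l}"
  have right: "(i + 1, l) \<in> ?C" if il: "(i, l) \<in> ?C" "start i l" for i l
  proof (cases "0 \<le> l")
    case True
    then have "even (i + l + int N)" using il(2) unfolding start_def by blast
    then obtain s where s: "i + l + int N = 2 * s" by (elim evenE)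
    show ?thesis
      using il(1) s True assms unfolding diamond_cells_def by (auto; presburger)
  next
    case False
    then have "even (i + l + int N + 1)" using il(2) unfolding start_def by simp
    then obtain s where s: "i + l + int N + 1 = 2 * s" by (elim evenE)
    have "i - l \<le> int N" using il(1) by (simp add: diamond_cells_def)
    then have "s - l \<le> int N" using s by linarith
    then have "i + 1 - l \<le> int N" using s by linarith
    then show ?thesis
      using il(1) s False assms unfolding diamond_cells_def by auto
  qed
  have left: "(i - 1, l) \<in> ?C" if il: "(i, l) \<in> ?C" "\<not> start i l" for i l
  proof (cases "0 \<le> l")
    case True
    then have "even (i + l + int N + 1)" using il(2) unfolding start_def by simp
    then obtain s where s: "i + l + int N + 1 = 2 * s" by (elim evenE)
    have "l - i \<le> int N" using il(1) by (simp add: diamond_cells_def)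
    then have "l - s \<le> - 1" using s by linarith
    then have "l - (i - 1) \<le> int N" using s by linarith
    moreover have "3 + (l - i) + 2 * int m \<le> int N + 2 * int k"
      if "l - i + 2 + 2 * int m \<le> int N + 2 * int k"
    proof -
      have "l - s + int m - int k \<le> - 2" using s that by linarith
      then show ?thesis using s by linarith
    qed
    ultimately show ?thesis
      using il(1) s True assms unfolding diamond_cells_def by auto
  next
    case False
    then have "even (i + l + int N)" using il(2) unfolding start_def by blast
    then obtain s where s: "i + l + int N = 2 * s" by (elim evenE)
    have "- i - l \<le> int N + 1" using il(1) by (simp add: diamond_cells_def)
    then have "0 \<le> s" using s by linarith
    then have "- i - l \<le> int N" using s by linarith
    then show ?thesis
      using il(1) s False assms unfolding diamond_cells_def by auto
  qed
  have "E \<in> matchings ?C"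
    unfolding matchings_def
  proof (intro CollectI conjI ballI subsetI)
    fix d c assume "d \<in> E" "c \<in> domino_cells d"
    then show "c \<in> ?C" using right by (auto simp: E_def)
  next
    show "pairwise (\<lambda>d e. domino_cells d \<inter> domino_cells e = {}) E"
      unfolding pairwise_def E_def using start_shift by auto
  next
    fix c assume c: "c \<in> ?C"
    obtain i l where il: "c = (i, l)" by (cases c)
    show "c \<in> \<Union>(domino_cells ` E)"
    proof (cases "start i l")
      case True
      then have "(False, i, l) \<in> E" using c il by (simp add: E_def)
      then show ?thesis using il by force
    next
      case False
      then have "(i - 1, l) \<in> ?C" "start (i - 1) l" using left c il start_shift[of "i - 1" l] by auto
      then have "(False, i - 1, l) \<in> E" by (simp add: E_def)
      then show ?thesis using il by force
    qed
  qed
  moreover have "finite ?C" unfolding diamond_cells_eq[OF assms(1-4)] by (rule finite_aztec_cells)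
  ultimately show ?thesis
    unfolding weight_def using assms(5) by (intro sum_pos2[of _ E]) (auto simp: finite_matchings)
qed

section \<open>The product formula\<close>

text \<open>With \<open>n = N + k - m - 1\<close> the number \<open>n + m - N\<close> of particle
  columns is \<open>k - 1\<close>, so the case distinctions in \<open>columns\<close> and
  \<open>pade_column\<close> agree.\<close>

lemma columns_pairing:
  assumes "1 \<le> m" "m \<le> N" "1 \<le> k" "k \<le> m + 1" "j < m"
  shows "fps_nth (columns N m (N + k - m - 1) a j * G) N = (- 1) ^ (m - 1 - j) * pairing N G (pade_column N m a k j)"
proof (cases "Suc j < k")
  case True
  then have "j < N + k - m - 1 + m - N" using assms by auto
  moreover have "j + (N - m + 1) + (m - 1 - j) = N" using assms by auto
  ultimately show ?thesis
    using True pairing_shifted_power[of j "N - m + 1" "m - 1 - j" N a G]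
    by (simp add: columns_def shifted_def pade_column_def)
next
  case False
  then have "\<not> j < N + k - m - 1 + m - N" using assms by auto
  moreover have "(j + N + 1 - m) + 0 + (m - 1 - j) = N" using assms by auto
  ultimately show ?thesis
    using False pairing_shifted_power[of "j + N + 1 - m" 0 "m - 1 - j" N a G]
    by (simp add: columns_def pade_column_def)
qed

lemma row_det_boundary_rows:
  assumes "1 \<le> m" "m \<le> N" "1 \<le> k" "k \<le> m + 1"
  shows "row_det m (boundary_rows N m (N + k - m - 1) a m) = Determinant.det (pade_matrix N m a k)"
  unfolding row_det_def
proof (intro arg_cong[of _ _ Determinant.det] eq_matI)
  fix i j assume "i < dim_row (pade_matrix N m a k)" "j < dim_col (pade_matrix N m a k)"
  then have ij: "i < m" "j < m" by (auto simp: pade_matrix_def)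
  have "columns_at N m (N + k - m - 1) a (m - 1 - i) j * geometric a =
      columns N m (N + k - m - 1) a j * boundary_series a (m - 1 - i)"
    by (simp add: columns_at_def boundary_series_def mult.assoc)
  then show "Matrix.mat m m (\<lambda>(i, j). (boundary_rows N m (N + k - m - 1) a m ! i) j) $$ (i, j) =
      pade_matrix N m a k $$ (i, j)"
    using ij columns_pairing[OF assms ij(2), of a "boundary_series a (m - 1 - i)"]
    by (simp add: nth_boundary_rows pade_matrix_def)
qed (auto simp: pade_matrix_def)

lemma gen_fun_eq_det:
  assumes "1 \<le> m" "m \<le> N" "1 \<le> k" "k \<le> m + 1"
  shows "gen_fun N m k a = (1 + a\<^sup>2) ^ ((N - m) * (N - m + 1) div 2) * Determinant.det (pade_matrix N m a k)"
proof -
  have "gen_fun N m k a = weight a (aztec_cells N m (N + k - m - 1))"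
    by (simp add: gen_fun_eq_weight diamond_cells_eq[OF assms])
  also have "\<dots> = (1 + a\<^sup>2) ^ ((N - m) * (N - m + 1) div 2) * row_det m (boundary_rows N m (N + k - m - 1) a m)"
    by (rule weight_aztec_cells_det) (use assms in auto)
  finally show ?thesis unfolding row_det_boundary_rows[OF assms] .
qed

lemma gen_fun_pos:
  assumes "1 \<le> m" "m \<le> N" "1 \<le> k" "k \<le> m + 1" "0 < a"
  shows "0 < gen_fun N m k a"
  unfolding gen_fun_eq_weight using assms by (rule weight_diamond_cells_pos)

text \<open>Positivity of the generating functions makes all the determinants nonzero, as the Pade
  lemmas require, and the power of \<open>1 + a\<^sup>2\<close> in \<open>gen_fun_eq_det\<close>
  does not depend on \<open>k\<close>.\<close>

lemma gen_fun_Suc: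
  assumes "1 \<le> m" "m \<le> N" "1 \<le> k" "k \<le> m" "0 < a"
  shows "gen_fun N m (Suc k) a = kappa N m k a * gen_fun N m k a"
proof -
  have "Determinant.det (pade_matrix N m a j) \<noteq> 0" if "1 \<le> j" "j \<le> m + 1" for j
    using gen_fun_pos[of m N j a] gen_fun_eq_det[of m N j a] assms that by auto
  then have "Determinant.det (pade_matrix N m a (Suc k)) = kappa N m k a * Determinant.det (pade_matrix N m a k)"
    using assms by (intro det_pade_matrix_Suc_kappa) auto
  then show ?thesis using assms by (simp add: gen_fun_eq_det)
qed

lemma gen_fun_full:
  assumes "1 \<le> m" "m \<le> N"
  shows "gen_fun N m (m + 1) a = (1 + a\<^sup>2) ^ (N * (N + 1) div 2)"
proof -
  have "diamond_cells N m (m + 1) = aztec_cells N m N"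
    using diamond_cells_eq[of m N "m + 1"] assms by simp
  then show ?thesis by (simp add: gen_fun_eq_weight weight_full_aztec)
qed

text \<open>Descending induction from the uncut diamond \<open>k = m + 1\<close>. Positivity of the
  left side of \<open>gen_fun_Suc\<close> shows that \<open>kappa\<close> is nonzero, so the
  recursion can be divided by it.\<close>

lemma gen_fun_eq_prod:
  assumes "1 \<le> m" "m \<le> N" "0 < a" "1 \<le> k" "k \<le> m + 1"
  shows "gen_fun N m k a = (1 + a\<^sup>2) ^ (N * (N + 1) div 2) * (\<Prod>j=k..m. 1 / kappa N m j a)"
  using assms(5,4)
proof (induction rule: inc_induct)
  case base
  then show ?case using gen_fun_full assms by simp
next
  case (step k)
  have "gen_fun N m (Suc k) a = kappa N m k a * gen_fun N m k a"
    using step assms by (intro gen_fun_Suc) auto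
  moreover have "0 < gen_fun N m (Suc k) a" using step assms by (intro gen_fun_pos) auto
  ultimately have "gen_fun N m k a = gen_fun N m (Suc k) a * (1 / kappa N m k a)" by auto
  moreover have "{k..m} = insert k {Suc k..m}" using step by auto
  ultimately show ?case using step by simp
qed

theorem theorem1p1:
  fixes N m k :: nat and a :: real
  assumes "N \<ge> 1" and "m \<in> {1..N}" and "k \<in> {1..m + 1}" and "0 < a" and "a \<le> 1"
  shows "gen_fun N m k a = (1 + a\<^sup>2) ^ (N * (N + 1) div 2) * (\<Prod>j=k..m. 1 / kappa N m j a)
    \<and> real (card (tilings (reduced_aztec N m k))) =
        2 ^ (N * (N + 1) div 2) * (\<Prod>j=k..m. 1 / kappa N m j 1)"
proof
  show "gen_fun N m k a = (1 + a\<^sup>2) ^ (N * (N + 1) div 2) * (\<Prod>j=k..m. 1 / kappa N m j a)"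
    using assms by (intro gen_fun_eq_prod) auto
  have "real (card (tilings (reduced_aztec N m k))) = gen_fun N m k 1"
    by (simp add: gen_fun_def)
  also have "\<dots> = (1 + 1\<^sup>2) ^ (N * (N + 1) div 2) * (\<Prod>j=k..m. 1 / kappa N m j 1)"
    using assms by (intro gen_fun_eq_prod) auto
  finally show "real (card (tilings (reduced_aztec N m k))) =
      2 ^ (N * (N + 1) div 2) * (\<Prod>j=k..m. 1 / kappa N m j 1)"
    by simp
qed

end
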